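(* Let $q$ be a prime power and let $\mathcal Q^+(5,q)$ be the Klein quadric of ${\rm PG}(5,q)$. Let $g$ be a Greek plane of $\mathcal Q^+(5,q)$. Let $\mathcal X$ be a set of $q^6-q^3$ planes of ${\rm PG}(5,q)$, each disjoint from $g$ and meeting $\mathcal Q^+(5,q)$ in a non--degenerate conic. Let $\mathcal Y$ be the set of the $q^3+q^2+q$ Greek planes of $\mathcal Q^+(5,q)$ distinct from $g$. Let $\mathcal Z$ be the set of all planes $\tau$ of ${\rm PG}(5,q)$ such that $\tau\cap\mathcal Q^+(5,q)$ is exactly a line of $g$ (there are $q-1$ such planes through each line of $g$, so $|\mathcal Z|=q^3-1$). Fix a line $\ell$ of $g$, let $\pi$ be the unique Latin plane of $\mathcal Q^+(5,q)$ through $\ell$, fix a point $P\in\ell$, and let $S$ be the set of the $q^2$ planes $\langle m_1,m_2\rangle$ where $m_1$ is a line of $\pi$ through $P$ different from $\ell$ and $m_2$ is a line of $g$ through $P$ different from $\ell$. Let $G$ be the stabilizer of $\mathcal Q^+(5,q)$ in ${\rm PGL}(6,q)$, let $H$ be a subgroup of the stabilizer of $g$ in $G$ which is isomorphic to ${\rm PGL}(3,q)$ and acts on the points and lines of $g$ in its natural representation, let $C$ be a Singer cyclic subgroup of $H$, and let $\mathcal T$ be the orbit of $S$ under $C$, i.e. the set of all images of planes of $S$ under elements of $C$ (it consists of $q^2(q^2+q+1)$ planes). Then there exists a hyperplane $\Gamma$ of ${\rm PG}(5,q)$ such that the number of elements of $\mathcal X\cup\mathcal Y\cup\mathcal Z\cup\mathcal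 T$ contained in $\Gamma$ is $q^3+2q^2+q-1$.
   Context: The Klein quadric $\mathcal Q^+(5,q)$ is the set of points of ${\rm PG}(5,q)$ satisfying $X_1X_2+X_3X_4+X_5X_6=0$. The planes contained in it form two families, each of $q^3+q^2+q+1$ planes, called Latin planes and Greek planes: two distinct planes of the same family share exactly one point, while planes of different families are either disjoint or meet in a line. A conic of a plane is the set of points satisfying a quadratic equation; it is non--degenerate if it does not split into lines (possibly over ${\rm GF}(q^2)$). A Singer cyclic subgroup of ${\rm PGL}(3,q)$ is a cyclic subgroup acting regularly on the points and on the lines of ${\rm PG}(2,q)$. *)

theory Defs
  imports
    "HOL-Analysis.Analysis"
    "HOL-Algebra.Bij"
    "HOL-Algebra.Elementary_Groups"
    "HOL-Algebra.Algebraic_Closure_Type"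
begin

text \<open>
  A point of the projective space of \<open>'a^'n\<close> is a one-dimensional vector subspace, and every
  other projective subspace is the set of points it contains. Incidence, intersection and
  disjointness are therefore the set-theoretic notions. The projective dimension is \<open>CARD('n) - 1\<close>.
\<close>

definition pg_points :: "('a::field^'n) set set" where
  "pg_points = {p. vec.subspace p \<and> vec.dim p = 1}"

definition points_of :: "('a::field^'n) set \<Rightarrow> ('a^'n) set set" where
  "points_of U = {p \<in> pg_points. p \<subseteq> U}"

definition pg_subspaces :: "nat \<Rightarrow> ('a::field^'n) set set set" where
  "pg_subspaces k = {points_of U | U. vec.subspace U \<and> vec.dim U = k + 1}"

abbreviation pg_lines :: "('a::field^'n) set set set" where
  "pg_lines \<equiv> pg_subspaces 1"

abbreviation pg_planes :: "('a::field^'n) set set set" where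
  "pg_planes \<equiv> pg_subspaces 2"

abbreviation pg5_hyperplanes :: "('a::field^6) set set set" where
  "pg5_hyperplanes \<equiv> pg_subspaces 4"

definition pg_span :: "('a::field^'n) set set \<Rightarrow> ('a^'n) set set" where
  "pg_span A = points_of (vec.span (\<Union>A))"

text \<open>
  Coordinates on a plane: an injective linear map from \<open>'a^3\<close> onto the underlying vector subspace.
  The image of a point of the coordinate plane under it is a point of the plane.
\<close>

definition plane_frame :: "('a::field^3 \<Rightarrow> 'a^'n) \<Rightarrow> ('a^'n) set set \<Rightarrow> bool" where
  "plane_frame \<phi> \<tau> \<longleftrightarrow>
     Vector_Spaces.linear (*s) (*s) \<phi> \<and> inj \<phi> \<and> \<tau> = (\<lambda>p. \<phi> ` p) ` pg_points"

text \<open>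
  A homogeneous quadratic polynomial in three variables, given by a (not necessarily symmetric)
  coefficient matrix; this also covers characteristic two.
\<close>

definition ternary_form :: "'a::comm_ring_1^3^3 \<Rightarrow> 'a^3 \<Rightarrow> 'a" where
  "ternary_form A x = (\<Sum>i\<in>UNIV. \<Sum>j\<in>UNIV. A $ i $ j * x $ i * x $ j)"

text \<open>The subfield with \<open>q\<^sup>2\<close> elements of the algebraic closure of \<open>'a\<close>, where \<open>q = CARD('a)\<close>.\<close>

definition quadratic_extension :: "'a::{field,finite} alg_closure set" where
  "quadratic_extension = {x. x ^ (CARD('a)\<^sup>2) = x}"

text \<open>
  The identity ranges over vectors with entries in the (infinite) algebraic closure, so it is an
  identity of polynomials. The linear forms may vanish, so that the zero polynomial splits.
\<close>

definition splits_into_lines :: "'a::{field,finite}^3^3 \<Rightarrow> bool" where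
  "splits_into_lines A \<longleftrightarrow>
     (\<exists>u v :: 'a alg_closure^3.
        (\<forall>i. u $ i \<in> quadratic_extension \<and> v $ i \<in> quadratic_extension) \<and>
        (\<forall>x. ternary_form (map_matrix to_ac A) x =
             (\<Sum>i\<in>UNIV. u $ i * x $ i) * (\<Sum>i\<in>UNIV. v $ i * x $ i)))"

definition nondegenerate_conic_in ::
    "('a::{field,finite}^'n) set set \<Rightarrow> ('a^'n) set set \<Rightarrow> bool" where
  "nondegenerate_conic_in \<tau> K \<longleftrightarrow>
     (\<exists>\<phi> A. plane_frame \<phi> \<tau> \<and> \<not> splits_into_lines A \<and>
        K = {\<phi> ` p | p. p \<in> pg_points \<and> (\<forall>x\<in>p. ternary_form A x = 0)})"

text \<open>The index type \<open>6\<close> is arithmetic modulo 6, so \<open>x $ 6\<close> is the same entry as \<open>x $ 0\<close>.\<close>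

definition klein_quadric :: "('a::field^6) set set" where
  "klein_quadric =
     {p \<in> pg_points. \<forall>x\<in>p. x $ 1 * x $ 2 + x $ 3 * x $ 4 + x $ 5 * x $ 6 = 0}"

text \<open>
  The two families of planes of the Klein quadric are determined only up to interchange, and so is
  the choice of the family called Latin.
\<close>

definition klein_families ::
    "('a::{field,finite}^6) set set set \<Rightarrow> ('a^6) set set set \<Rightarrow> bool" where
  "klein_families Latin Greek \<longleftrightarrow>
     Latin \<union> Greek = {\<alpha> \<in> pg_planes. \<alpha> \<subseteq> klein_quadric} \<and>
     Latin \<inter> Greek = {} \<and>
     (\<forall>F\<in>{Latin, Greek}.
        card F = CARD('a) ^ 3 + CARD('a) ^ 2 + CARD('a) + 1 \<and>
        (\<forall>\<alpha>\<in>F. \<forall>\<beta>\<in>F. \<alpha> \<noteq> \<beta> \<longrightarrow> (\<exists>p. \<alpha> \<inter> \<beta> = {p}))) \<and>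
     (\<forall>\<alpha>\<in>Latin. \<forall>\<beta>\<in>Greek. \<alpha> \<inter> \<beta> = {} \<or> \<alpha> \<inter> \<beta> \<in> pg_lines)"

text \<open>
  The projective general linear group as a group of permutations of the points. It acts on lines
  and planes, being sets of points, by taking images.
\<close>

definition projectivity :: "'a::field^'n^'n \<Rightarrow> ('a^'n) set \<Rightarrow> ('a^'n) set" where
  "projectivity M = (\<lambda>p\<in>pg_points. (*v) M ` p)"

definition PGL :: "(('a::field^'n) set \<Rightarrow> ('a^'n) set) monoid" where
  "PGL = BijGroup pg_points \<lparr>carrier := {projectivity M | M. invertible M}\<rparr>"

text \<open>
  For a set \<open>H\<close> of projectivities stabilizing the plane \<open>g\<close>: up to a choice of coordinates on \<open>g\<close>,
  the group \<open>H\<close> is the group \<open>PGL(3,q)\<close> in its action on the points (and thus on the lines) of the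
  projective plane.
\<close>

definition natural_PGL3_on ::
    "('a::field^'n) set set \<Rightarrow> (('a^'n) set \<Rightarrow> ('a^'n) set) set \<Rightarrow> bool" where
  "natural_PGL3_on g H \<longleftrightarrow>
     (\<exists>(\<phi> :: 'a^3 \<Rightarrow> 'a^'n) \<psi>.
        plane_frame \<phi> g \<and> \<psi> \<in> iso PGL (PGL\<lparr>carrier := H\<rparr>) \<and>
        (\<forall>h\<in>carrier PGL. \<forall>p\<in>pg_points. \<psi> h (\<phi> ` p) = \<phi> ` (h p)))"

definition singer_cyclic_on ::
    "('a::field^'n) set set \<Rightarrow> (('a^'n) set \<Rightarrow> ('a^'n) set) set \<Rightarrow> bool" where
  "singer_cyclic_on g C \<longleftrightarrow>
     subgroup C PGL \<and> cyclic_group (PGL\<lparr>carrier := C\<rparr>) \<and>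
     (\<forall>c\<in>C. c ` g = g) \<and>
     (\<forall>p\<in>g. \<forall>p'\<in>g. \<exists>!c. c \<in> C \<and> c p = p') \<and>
     (\<forall>l\<in>pg_lines. \<forall>l'\<in>pg_lines. l \<subseteq> g \<longrightarrow> l' \<subseteq> g \<longrightarrow> (\<exists>!c. c \<in> C \<and> c ` l = l'))"

end

theory Submission
  imports Defs
begin

text \<open>
  Take any hyperplane \<open>\<Gamma>\<close> containing \<open>g\<close>; it is the tangent hyperplane \<open>R\<^sup>\<bottom>\<close> at a point
  \<open>R\<close> of \<open>g\<close>. For dimension reasons every plane of \<open>\<Gamma>\<close> meets \<open>g\<close>, so \<open>\<X>\<close> contributes nothing.
  A singular plane lies in \<open>R\<^sup>\<bottom>\<close> iff it contains \<open>R\<close>; as the Singer group is transitive on the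
  points of \<open>g\<close>, and each of the \<open>q(q\<^sup>2 + q + 1)\<close> other Greek planes meets \<open>g\<close> in one point,
  \<open>\<Y>\<close> contributes \<open>q\<close>. A plane meeting the quadric in a line \<open>m\<close> of \<open>g\<close> lies in \<open>R\<^sup>\<bottom>\<close> iff
  \<open>R \<in> m\<close>, and through \<open>m\<close> these are the \<open>q + 1\<close> planes of \<open>m\<^sup>\<bottom>\<close> except the two singular ones, so
  \<open>\<Z>\<close> contributes \<open>(q + 1)(q - 1)\<close>. A plane of \<open>c \<S>\<close> lies in \<open>R\<^sup>\<bottom>\<close> iff \<open>R \<in> c \<ell>\<close>; there are
  \<open>q + 1\<close> such \<open>c\<close>, and the sets \<open>c \<S>\<close> are disjoint because such a plane meets the quadric in two
  lines intersecting in \<open>c P\<close>. Hence \<open>\<T>\<close> contributes \<open>(q + 1) q\<^sup>2\<close>.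
\<close>

unbundle no fps_syntax

subsection \<open>Counting subspaces over a finite field\<close>

text \<open>The span of \<open>x\<close> and \<open>A\<close> lies in \<open>B\<close> and already
  has its dimension.\<close>

lemma subspace_eq_span_insert:
  fixes A B :: "('a::field^'n) set"
  assumes "vec.subspace A" "vec.subspace B" "A \<subseteq> B" "vec.dim B = vec.dim A + 1"
    and "x \<in> B" "x \<notin> A"
  shows "B = vec.span (insert x A)"
proof -
  have "vec.span (insert x A) \<subseteq> B"
    using assms by (intro vec.span_minimal) auto
  moreover have "vec.dim (vec.span (insert x A)) = vec.dim A + 1"
    using assms by (simp add: vec.dim_insert vec.span_eq_iff[THEN iffD2])
  ultimately show ?thesis
    using assms vec.subspace_dim_equal[of "vec.span (insert x A)" B] by auto
qed

lemma subspace_eq_if_dim: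
  fixes A B :: "('a::field^'n) set"
  assumes "vec.subspace A" "vec.subspace B" "A \<subseteq> B" "vec.dim A = vec.dim B"
  shows "A = B"
  using assms vec.subspace_dim_equal[of A B] by simp

text \<open>Each vector of the span is \<open>k *s x + u\<close> for exactly one scalar
  \<open>k\<close> and one \<open>u\<close> in \<open>U\<close>, so such pairs count it.\<close>

lemma card_span_insert:
  fixes x :: "'a::{field,finite}^'n"
  assumes U: "vec.subspace U" and x: "x \<notin> U"
  shows "card (vec.span (insert x U)) = CARD('a) * card U"
proof -
  have "bij_betw (\<lambda>(k, u). k *s x + u) (UNIV \<times> U) (vec.span (insert x U))"
    unfolding bij_betw_def
  proof
    show "inj_on (\<lambda>(k, u). k *s x + u) (UNIV \<times> U)"
    proof (clarsimp simp: inj_on_def)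
      fix k u k' u' assume u: "u \<in> U" "u' \<in> U" and eq: "k *s x + u = k' *s x + u'"
      have "(k - k') *s x = u' - u" using eq by (simp add: algebra_simps)
      then have "(k - k') *s x \<in> U" using u U by (simp add: vec.subspace_diff)
      \<comment> \<open>For \<open>k \<noteq> k'\<close> this puts \<open>x\<close> itself into
        \<open>U\<close>; for \<open>k = k'\<close> the inverse is 0 and the membership is
        trivial.\<close>
      then have "inverse (k - k') *s ((k - k') *s x) \<in> U"
        using U by (rule vec.subspace_scale[rotated])
      then have "(inverse (k - k') * (k - k')) *s x \<in> U"
        by (simp only: vector_smult_assoc)
      then have "k = k'"
        using x by (cases "k = k'") simp_all
      then show "k = k' \<and> u = u'" using eq by simp
    qed
    show "(\<lambda>(k, u). k *s x + u) ` (UNIV \<times> U) = vec.span (insert x U)"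
    proof (intro equalityI subsetI)
      fix y assume "y \<in> vec.span (insert x U)"
      then obtain k where "y - k *s x \<in> U"
        using U by (auto simp: vec.span_insert vec.span_eq_iff[THEN iffD2])
      then show "y \<in> (\<lambda>(k, u). k *s x + u) ` (UNIV \<times> U)"
        by (intro image_eqI[of _ _ "(k, y - k *s x)"]) auto
    qed (auto intro: vec.span_add vec.span_scale vec.span_base)
  qed
  then show ?thesis by (metis bij_betw_same_card card_cartesian_product)
qed

text \<open>Induction over a basis: by \<open>card_span_insert\<close> every basis vector multiplies
  the size by the order of the field.\<close>

lemma card_subspace:
  fixes U :: "('a::{field,finite}^'n) set"
  assumes "vec.subspace U"
  shows "card U = CARD('a) ^ vec.dim U"
proof -
  have "card (vec.span B) = CARD('a) ^ card B" if "finite B" "vec.independent B"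
    for B :: "('a^'n) set"
    using that
  proof (induction rule: finite_induct)
    case (insert x B)
    have "vec.span (insert x (vec.span B)) = vec.span (insert x B)"
      by (simp only: vec.span_insert vec.span_span)
    then show ?case
      using insert card_span_insert[of "vec.span B" x]
      by (auto simp: vec.independent_insert)
  qed simp
  then show ?thesis
    by (metis assms vec.basis_subspace_exists vec.dim_eq_card_independent)
qed

lemma CARD_field_ge_2: "2 \<le> CARD('a::{field,finite})"
proof -
  have "card {0, 1::'a} \<le> CARD('a)" by (intro card_mono) auto
  then show ?thesis by simp
qed

text \<open>The sets \<open>V - A\<close>, for \<open>V\<close> in the family, partition \<open>B - A\<close>.\<close>

lemma card_subspaces_between:
  fixes A B :: "('a::{field,finite}^'n) set"
  assumes A: "vec.subspace A" and B: "vec.subspace B" and AB: "A \<subseteq> B"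
  shows "card {V. vec.subspace V \<and> A \<subseteq> V \<and> V \<subseteq> B \<and> vec.dim V = vec.dim A + 1}
      * (CARD('a) ^ (vec.dim A + 1) - CARD('a) ^ vec.dim A)
    = CARD('a) ^ vec.dim B - CARD('a) ^ vec.dim A" (is "card ?F * _ = _")
proof -
  have V_eq: "V = vec.span (insert x A)" if "V \<in> ?F" "x \<in> V - A" for V x
    using that A by (intro subspace_eq_span_insert) auto
  have "B - A = (\<Union>V\<in>?F. V - A)"
  proof (intro equalityI subsetI)
    fix x assume x: "x \<in> B - A"
    have "vec.span (insert x A) \<subseteq> B"
      using x B AB by (intro vec.span_minimal) auto
    moreover have "vec.dim (vec.span (insert x A)) = vec.dim A + 1"
      using x A by (simp add: vec.dim_insert vec.span_eq_iff[THEN iffD2])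
    ultimately have "vec.span (insert x A) \<in> ?F"
      using vec.span_superset[of "insert x A"] by auto
    moreover have "x \<in> vec.span (insert x A)" by (simp add: vec.span_base)
    ultimately show "x \<in> (\<Union>V\<in>?F. V - A)" using x by blast
  qed auto
  also have "card \<dots> = (\<Sum>V\<in>?F. card (V - A))"
  proof (rule card_UN_disjoint)
    show "\<forall>V\<in>?F. \<forall>W\<in>?F. V \<noteq> W \<longrightarrow> (V - A) \<inter> (W - A) = {}"
      using V_eq by (metis (no_types, lifting) Int_iff all_not_in_conv)
  qed auto
  also have "\<dots> = (\<Sum>V\<in>?F. CARD('a) ^ (vec.dim A + 1) - CARD('a) ^ vec.dim A)"
    by (intro sum.cong refl) (auto simp: card_Diff_subset card_subspace A)
  finally have "card (B - A) = card ?F * (CARD('a) ^ (vec.dim A + 1) - CARD('a) ^ vec.dim A)"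
    by (simp only: sum_constant of_nat_id)
  moreover have "card (B - A) = CARD('a) ^ vec.dim B - CARD('a) ^ vec.dim A"
    using AB by (simp add: card_Diff_subset card_subspace A B)
  ultimately show ?thesis by (simp only:)
qed

text \<open>The general count factors because \<open>q^2 - 1 = (q + 1) * (q - 1)\<close>. It serves
  for the lines of a plane through a point and for the planes between a line \<open>L\<close> and
  \<open>klein_perp L\<close>.\<close>

lemma card_subspaces_between_2:
  fixes A B :: "('a::{field,finite}^'n) set"
  assumes A: "vec.subspace A" and B: "vec.subspace B" and AB: "A \<subseteq> B"
    and dim: "vec.dim B = vec.dim A + 2"
  shows "card {V. vec.subspace V \<and> A \<subseteq> V \<and> V \<subseteq> B \<and> vec.dim V = vec.dim A + 1} = CARD('a) + 1"
proof -
  define n where "n = card {V. vec.subspace V \<and> A \<subseteq> V \<and> V \<subseteq> B \<and> vec.dim V = vec.dim A + 1}"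
  define c Q where "c = CARD('a)" and "Q = c ^ vec.dim A"
  \<comment> \<open>Writing the order as \<open>r + 2\<close> turns truncated subtraction into
    addition and keeps the factor \<open>r + 1\<close> positive.\<close>
  obtain r where r: "c = r + 2"
    unfolding c_def using CARD_field_ge_2[where 'a='a] by (metis add.commute le_Suc_ex)
  have "Q > 0" unfolding Q_def r by simp
  have "n * (c * Q - Q) = c * (c * Q) - Q"
    using card_subspaces_between[OF A B AB] unfolding dim n_def[symmetric] c_def[symmetric]
    by (simp add: Q_def)
  moreover have "c * Q - Q = (r + 1) * Q" by (simp add: r)
  moreover have "c * (c * Q) - Q = (r + 3) * ((r + 1) * Q)"
    by (simp add: r algebra_simps)
  ultimately have "n * ((r + 1) * Q) = (r + 3) * ((r + 1) * Q)" by metis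
  then have "n = r + 3" using \<open>Q > 0\<close> by (simp only: mult_cancel2) simp
  then show ?thesis unfolding n_def c_def[symmetric] r by simp
qed

lemma card_points_of_plane:
  fixes B :: "('a::{field,finite}^'n) set"
  assumes B: "vec.subspace B" "vec.dim B = 3"
  shows "card (points_of B) = CARD('a) ^ 2 + CARD('a) + 1"
proof -
  obtain r where r: "CARD('a) = r + 2"
    using CARD_field_ge_2[where 'a='a] by (metis add.commute le_Suc_ex)
  \<comment> \<open>A point of \<open>B\<close> is a subspace one dimension above the zero space, so
    the general count applies with \<open>A = {0}\<close>.\<close>
  have "points_of B = {V. vec.subspace V \<and> {0} \<subseteq> V \<and> V \<subseteq> B \<and> vec.dim V = vec.dim {0::'a^'n} + 1}"
    by (auto simp: points_of_def pg_points_def vec.subspace_0)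
  then have "card (points_of B) * (r + 1) = (r + 2) ^ 3 - 1"
    using card_subspaces_between[of "{0}" B] B by (simp add: vec.subspace_0 r)
  also have "\<dots> = ((r + 2)\<^sup>2 + (r + 2) + 1) * (r + 1)"
    by (simp add: power3_eq_cube power2_eq_square algebra_simps)
  finally have "card (points_of B) = (r + 2)\<^sup>2 + (r + 2) + 1"
    by (simp only: mult_cancel2) simp
  then show ?thesis unfolding r .
qed

text \<open>If only zero were common, addition would map \<open>A \<times> B\<close> injectively
  into \<open>W\<close>, and comparing the powers of the field order contradicts
  \<open>dim\<close>.\<close>

lemma Int_nontrivial_if_dim:
  fixes A B W :: "('a::{field,finite}^'n) set"
  assumes sub: "vec.subspace A" "vec.subspace B" "vec.subspace W" "A \<subseteq> W" "B \<subseteq> W"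
    and dim: "vec.dim W < vec.dim A + vec.dim B"
  shows "\<exists>x. x \<in> A \<and> x \<in> B \<and> x \<noteq> 0"
proof (rule ccontr)
  assume contr: "\<not> ?thesis"
  have "x = x' \<and> y = y'"
    if xy: "x \<in> A" "y \<in> B" "x' \<in> A" "y' \<in> B" "x + y = x' + y'" for x y x' y'
  proof -
    have "x - x' = y' - y" using xy(5) by (metis add_diff_cancel_left' diff_add_eq diff_diff_eq2)
    then have "x - x' \<in> A \<and> x - x' \<in> B" using xy sub by (metis vec.subspace_diff)
    then have "x - x' = 0" using contr by blast
    then show ?thesis using xy(5) by simp
  qed
  then have "inj_on (\<lambda>(x, y). x + y) (A \<times> B)"
    unfolding inj_on_def by fast
  moreover have "(\<lambda>(x, y). x + y) ` (A \<times> B) \<subseteq> W"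
    using sub by (auto intro!: vec.subspace_add)
  ultimately have "card (A \<times> B) \<le> card W"
    by (intro card_inj_on_le[of "\<lambda>(x, y). x + y"]) auto
  then have "CARD('a) ^ (vec.dim A + vec.dim B) \<le> CARD('a) ^ vec.dim W"
    using sub by (simp add: card_cartesian_product card_subspace power_add)
  then have "vec.dim A + vec.dim B \<le> vec.dim W"
    using CARD_field_ge_2[where 'a='a] by (subst (asm) power_increasing_iff) auto
  then show False using dim by simp
qed

subsection \<open>The Klein form\<close>

definition klein_form :: "'a::comm_ring_1^6 \<Rightarrow> 'a" where
  "klein_form x = x $ 1 * x $ 2 + x $ 3 * x $ 4 + x $ 5 * x $ 6"

text \<open>The polar form of \<open>klein_form\<close>, given by coordinates;
  \<open>klein_form_add\<close> is its characteristic relation, also in characteristic two.\<close>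

definition klein_bilin :: "'a::comm_ring_1^6 \<Rightarrow> 'a^6 \<Rightarrow> 'a" where
  "klein_bilin x y = x $ 1 * y $ 2 + x $ 2 * y $ 1 + x $ 3 * y $ 4 + x $ 4 * y $ 3
     + x $ 5 * y $ 6 + x $ 6 * y $ 5"

lemma klein_form_add: "klein_form (x + y) = klein_form x + klein_form y + klein_bilin x y"
  by (simp add: klein_form_def klein_bilin_def algebra_simps)

lemma klein_form_scale [simp]: "klein_form (c *s x) = c\<^sup>2 * klein_form x"
  by (simp add: klein_form_def power2_eq_square algebra_simps)

lemma klein_form_0 [simp]: "klein_form 0 = 0"
  by (simp add: klein_form_def)

lemma klein_bilin_simps [simp]:
  "klein_bilin (x + y) z = klein_bilin x z + klein_bilin y z"
  "klein_bilin z (x + y) = klein_bilin z x + klein_bilin z y"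
  "klein_bilin (x - y) z = klein_bilin x z - klein_bilin y z"
  "klein_bilin z (x - y) = klein_bilin z x - klein_bilin z y"
  "klein_bilin (c *s x) z = c * klein_bilin x z"
  "klein_bilin z (c *s x) = c * klein_bilin z x"
  "klein_bilin 0 z = 0"
  "klein_bilin z 0 = 0"
  by (simp_all add: klein_bilin_def algebra_simps)

lemma klein_bilin_commute: "klein_bilin x y = klein_bilin y x"
  by (simp add: klein_bilin_def algebra_simps)

lemma exhaust_6:
  fixes x :: 6
  shows "x = 1 \<or> x = 2 \<or> x = 3 \<or> x = 4 \<or> x = 5 \<or> x = 6"
proof (induct x)
  case (of_int z)
  \<comment> \<open>Representatives run from 0 to 5, and 0 is the index 6.\<close>
  then have "z = 0 \<or> z = 1 \<or> z = 2 \<or> z = 3 \<or> z = 4 \<or> z = 5" by fastforce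
  then show ?case by auto
qed

text \<open>Pairing with the six unit vectors reads off the coordinates of \<open>x\<close>, swapped
  in pairs.\<close>

lemma klein_bilin_nondegenerate:
  fixes x :: "'a::field^6"
  assumes "\<And>y. klein_bilin x y = 0"
  shows "x = 0"
proof -
  have "x $ 1 = 0" "x $ 2 = 0" "x $ 3 = 0" "x $ 4 = 0" "x $ 5 = 0" "x $ 6 = 0"
    using assms[of "axis 1 1"] assms[of "axis 2 1"] assms[of "axis 3 1"]
      assms[of "axis 4 1"] assms[of "axis 5 1"] assms[of "axis 6 1"]
    by (simp_all add: klein_bilin_def axis_def)
  then have "x $ i = 0" for i using exhaust_6[of i] by (elim disjE) simp_all
  then show ?thesis by (simp add: vec_eq_iff)
qed

text \<open>Orthogonal complement for the polar form; for a point of the quadric it is the tangent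
  hyperplane. Arbitrary sets are allowed so that conditions can be imposed one vector at a
  time.\<close>

definition klein_perp :: "('a::field^6) set \<Rightarrow> ('a^6) set" where
  "klein_perp S = {x. \<forall>a\<in>S. klein_bilin a x = 0}"

lemma subspace_klein_perp: "vec.subspace (klein_perp S)"
  by (auto simp: klein_perp_def vec.subspace_def)

text \<open>For fixed \<open>x\<close> the vectors orthogonal to \<open>x\<close> form a subspace,
  which contains the span once it contains \<open>S\<close>.\<close>

lemma klein_perp_span [simp]: "klein_perp (vec.span S) = klein_perp S"
proof
  show "klein_perp S \<subseteq> klein_perp (vec.span S)"
  proof
    fix x assume x: "x \<in> klein_perp S"
    have "vec.span S \<subseteq> {a. klein_bilin a x = 0}"
      using x by (intro vec.span_minimal) (auto simp: klein_perp_def vec.subspace_def)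
    then show "x \<in> klein_perp (vec.span S)" by (auto simp: klein_perp_def)
  qed
qed (auto simp: klein_perp_def vec.span_base)

text \<open>Each vector of \<open>S\<close> imposes one linear equation, which lowers the dimension
  by at most one.\<close>

lemma dim_Int_klein_perp_ge:
  fixes U :: "('a::field^6) set"
  assumes "finite S" "vec.subspace U"
  shows "vec.dim U \<le> vec.dim (U \<inter> klein_perp S) + card S"
  using assms
proof (induction rule: finite_induct)
  case empty then show ?case by (simp add: klein_perp_def)
next
  case (insert a S)
  let ?V = "U \<inter> klein_perp S" and ?W = "U \<inter> klein_perp (insert a S)"
  have V: "vec.subspace ?V" and W: "vec.subspace ?W"
    using insert.prems by (simp_all add: vec.subspace_inter subspace_klein_perp)
  have "vec.dim ?V \<le> vec.dim ?W + 1"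
  proof (cases "?V \<subseteq> ?W")
    case True
    then show ?thesis using vec.dim_subset[of ?V ?W] by linarith
  next
    case False
    then obtain u where u: "u \<in> ?V" "klein_bilin a u \<noteq> 0" by (auto simp: klein_perp_def)
    have "?V \<subseteq> vec.span (insert u ?W)"
    proof
      fix x assume x: "x \<in> ?V"
      \<comment> \<open>The coefficient for which \<open>x - ?c *s u\<close> is orthogonal to
        \<open>a\<close>.\<close>
      let ?c = "klein_bilin a x / klein_bilin a u"
      have "x - ?c *s u \<in> ?V"
        using x u by (intro vec.subspace_diff[OF V] vec.subspace_scale[OF V]) simp_all
      then have "x - ?c *s u \<in> ?W" using u by (auto simp: klein_perp_def)
      then show "x \<in> vec.span (insert u ?W)"
        by (metis vec.span_base vec.span_breakdown_eq)
    qed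
    then have "vec.dim ?V \<le> vec.dim (insert u ?W)" by (rule vec.dim_mono)
    also have "\<dots> \<le> vec.dim ?W + 1" by (simp add: vec.dim_insert)
    finally show ?thesis .
  qed
  then show ?case using insert by simp
qed

text \<open>Both inequalities come from the preceding lemma; the upper one uses that the perpendicular
  space of a whole basis, which extends a basis of \<open>U\<close>, is zero.\<close>

lemma dim_klein_perp:
  fixes U :: "('a::field^6) set"
  assumes U: "vec.subspace U"
  shows "vec.dim (klein_perp U) + vec.dim U = 6"
proof -
  obtain B where B: "B \<subseteq> U" "vec.independent B" "U \<subseteq> vec.span B" "card B = vec.dim U"
    by (rule vec.basis_exists)
  obtain E where E: "B \<subseteq> E" "vec.independent E" "UNIV \<subseteq> vec.span E"
    using vec.maximal_independent_subset_extend[OF subset_UNIV B(2)] by metis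
  have fin: "finite B" "finite E" using B E by (auto intro: vec.finiteI_independent)
  have "U = vec.span B" using B U by (metis subset_antisym vec.span_minimal)
  then have perp: "klein_perp U = klein_perp B" by simp
  have "x = 0" if "x \<in> klein_perp UNIV" for x :: "'a^6"
    using that klein_bilin_nondegenerate[of x] by (simp add: klein_perp_def klein_bilin_commute)
  moreover have "klein_perp E = klein_perp UNIV"
    by (metis E(3) klein_perp_span top.extremum_uniqueI)
  ultimately have perp_E: "vec.dim (klein_perp E) = 0"
    by (auto simp only: vec.dim_eq_0)
  have "vec.dim (UNIV::('a^6) set) \<le> vec.dim (UNIV \<inter> klein_perp B) + card B"
    using fin by (intro dim_Int_klein_perp_ge) auto
  moreover have dimU: "vec.dim (UNIV::('a^6) set) = 6" by (simp add: card_cart_basis)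
  moreover have "vec.dim (klein_perp B) \<le> vec.dim (klein_perp B \<inter> klein_perp (E - B)) + card (E - B)"
    using fin by (intro dim_Int_klein_perp_ge subspace_klein_perp) auto
  moreover have "klein_perp B \<inter> klein_perp (E - B) = klein_perp E"
    using E by (auto simp: klein_perp_def)
  moreover have "card E = 6"
    using E dimU by (metis subset_UNIV vec.basis_card_eq_dim)
  moreover have "card (E - B) = card E - card B" "card B \<le> card E"
    using fin E by (auto simp: card_Diff_subset card_mono)
  ultimately show ?thesis using B(4) perp perp_E by simp
qed

section \<open>Singular subspaces and planes meeting the quadric in lines\<close>

definition klein_cone :: "('a::field^6) set" where
  "klein_cone = {x. klein_form x = 0}"

lemma klein_perp_galois: "A \<subseteq> klein_perp B \<longleftrightarrow> B \<subseteq> klein_perp A"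
  by (auto simp: klein_perp_def subset_iff) (metis klein_bilin_commute)+

lemma klein_perp_antimono: "A \<subseteq> B \<Longrightarrow> klein_perp B \<subseteq> klein_perp A"
  by (auto simp: klein_perp_def)

text \<open>For \<open>a\<close> and \<open>x\<close> in \<open>U\<close> the vectors
  \<open>a\<close>, \<open>x\<close> and \<open>a + x\<close> are all singular, so in
  \<open>klein_form_add\<close> only the polar form remains.\<close>

lemma subset_klein_perp_if_singular:
  fixes U :: "('a::field^6) set"
  assumes "vec.subspace U" "U \<subseteq> klein_cone"
  shows "U \<subseteq> klein_perp U"
proof
  fix x assume x: "x \<in> U"
  have "klein_bilin a x = 0" if "a \<in> U" for a
    using assms x that vec.subspace_add[of U a x] klein_form_add[of a x]
    by (auto simp: klein_cone_def subset_iff)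
  then show "x \<in> klein_perp U" by (simp add: klein_perp_def)
qed

text \<open>Such a plane lies in its perpendicular space, and both have dimension 3 because the
  dimensions add up to 6.\<close>

lemma klein_perp_singular_plane:
  fixes U :: "('a::field^6) set"
  assumes "vec.subspace U" "vec.dim U = 3" "U \<subseteq> klein_cone"
  shows "klein_perp U = U"
  using assms subset_klein_perp_if_singular[of U] dim_klein_perp[of U]
    subspace_eq_if_dim[of U "klein_perp U"]
  by (simp add: subspace_klein_perp)

text \<open>If some \<open>v\<close> in \<open>W\<close> were not orthogonal to \<open>L\<close>, a
  suitable translate of \<open>v\<close> by \<open>L\<close> would be a further singular vector.
  Conversely, orthogonality makes the form at \<open>u + k *s v\<close> equal to
  \<open>k^2 * klein_form v\<close>, which for nonsingular \<open>v\<close> vanishes only at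
  \<open>k = 0\<close>.\<close>

lemma Int_klein_cone_eq_line_iff:
  fixes W L :: "('a::field^6) set"
  assumes W: "vec.subspace W" "vec.dim W = 3" and L: "vec.subspace L" "vec.dim L = 2"
    and LW: "L \<subseteq> W" "L \<subseteq> klein_cone"
  shows "W \<inter> klein_cone = L \<longleftrightarrow> W \<subseteq> klein_perp L \<and> \<not> W \<subseteq> klein_cone"
proof
  assume eq: "W \<inter> klein_cone = L"
  have "klein_bilin u v = 0" if u: "u \<in> L" and v: "v \<in> W" for u v
  proof (cases "v \<in> L")
    case True
    then show ?thesis
      using subset_klein_perp_if_singular[OF L(1) LW(2)] u by (auto simp: klein_perp_def)
  next
    case False
    show ?thesis
    proof (rule ccontr)
      assume nz: "klein_bilin u v \<noteq> 0"
      \<comment> \<open>Solves \<open>klein_form (c *s u + v) = 0\<close>, which is linear in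
        \<open>c\<close> because \<open>u\<close> is singular.\<close>
      define c where "c = - klein_form v / klein_bilin u v"
      have cu: "c *s u \<in> L" using u L(1) by (rule vec.subspace_scale[rotated])
      have "klein_form u = 0" using u LW(2) by (auto simp: klein_cone_def)
      then have "klein_form (c *s u + v) = klein_form v + c * klein_bilin u v"
        by (simp add: klein_form_add)
      also have "\<dots> = 0" using nz by (simp add: c_def)
      finally have "klein_form (c *s u + v) = 0" .
      moreover have "c *s u + v \<in> W"
        using cu LW(1) v W(1) by (auto intro: vec.subspace_add)
      ultimately have "c *s u + v \<in> L" using eq by (auto simp: klein_cone_def)
      then have "(c *s u + v) - c *s u \<in> L" using cu L(1) by (blast intro: vec.subspace_diff)
      then show False using False by simp
    qed
  qed
  \<comment> \<open>Otherwise \<open>W = L\<close>, against the dimensions 3 and 2.\<close>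
  moreover have "\<not> W \<subseteq> klein_cone" using eq W(2) L(2) by (metis Int_absorb2 numeral_eq_iff semiring_norm(89))
  ultimately show "W \<subseteq> klein_perp L \<and> \<not> W \<subseteq> klein_cone"
    by (auto simp: klein_perp_def)
next
  assume r: "W \<subseteq> klein_perp L \<and> \<not> W \<subseteq> klein_cone"
  then obtain v where v: "v \<in> W" "klein_form v \<noteq> 0" by (auto simp: klein_cone_def)
  then have "v \<notin> L" using LW by (auto simp: klein_cone_def)
  then have span: "W = vec.span (insert v L)"
    using W L LW v by (intro subspace_eq_span_insert) auto
  have "w \<in> L" if w: "w \<in> W" "klein_form w = 0" for w
  proof -
    obtain k where k: "w - k *s v \<in> L"
      using w(1) L(1) unfolding span by (auto simp: vec.span_insert vec.span_eq_iff[THEN iffD2])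
    define u where "u = w - k *s v"
    have u: "u \<in> L" "w = u + k *s v" using k by (simp_all add: u_def)
    have "klein_bilin u v = 0" using r v u(1) by (auto simp: klein_perp_def)
    moreover have "klein_form u = 0" using u(1) LW by (auto simp: klein_cone_def)
    ultimately have "k = 0" using v(2) w(2) unfolding u(2) by (simp add: klein_form_add)
    then show ?thesis using k by simp
  qed
  then show "W \<inter> klein_cone = L" using LW by (auto simp: klein_cone_def)
qed

text \<open>\<open>L\<close> and a vector of \<open>R\<close> outside it span \<open>U\<close>, so
  \<open>x\<close> lies in \<open>klein_perp U\<close>, which is \<open>U\<close>.\<close>

lemma klein_perp_line_point:
  fixes U L R :: "('a::field^6) set"
  assumes U: "vec.subspace U" "vec.dim U = 3" "U \<subseteq> klein_cone"
    and L: "vec.subspace L" "vec.dim L = 2" "L \<subseteq> U"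
    and R: "R \<subseteq> U" "\<not> R \<subseteq> L"
    and x: "x \<in> klein_perp L" "x \<in> klein_perp R"
  shows "x \<in> U"
proof -
  obtain r where r: "r \<in> R" "r \<notin> L" using R by auto
  then have "U = vec.span (insert r L)"
    using U L R by (intro subspace_eq_span_insert) auto
  moreover have "x \<in> klein_perp (insert r L)"
    using x r by (auto simp: klein_perp_def)
  ultimately have "x \<in> klein_perp U" by simp
  then show ?thesis using klein_perp_singular_plane[OF U] by simp
qed

text \<open>If \<open>R\<close> were not in \<open>L\<close>, then
  \<open>klein_perp_line_point\<close> would put all of \<open>W\<close> into the singular plane
  \<open>U\<close>; the converse holds since \<open>W\<close> is orthogonal to
  \<open>L\<close>.\<close>

lemma tangent_plane_subset_klein_perp_iff:
  fixes U L R W :: "('a::field^6) set"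
  assumes U: "vec.subspace U" "vec.dim U = 3" "U \<subseteq> klein_cone"
    and L: "vec.subspace L" "vec.dim L = 2" "L \<subseteq> U"
    and R: "R \<subseteq> U"
    and W: "vec.subspace W" "vec.dim W = 3" "W \<inter> klein_cone = L"
  shows "W \<subseteq> klein_perp R \<longleftrightarrow> R \<subseteq> L"
proof -
  have WL: "W \<subseteq> klein_perp L" "\<not> W \<subseteq> klein_cone"
    using Int_klein_cone_eq_line_iff[of W L] assms by auto
  show ?thesis
  proof
    assume "W \<subseteq> klein_perp R"
    then show "R \<subseteq> L"
      using klein_perp_line_point[OF U L R] WL U(3) by blast
  next
    assume "R \<subseteq> L"
    then show "W \<subseteq> klein_perp R" using WL klein_perp_antimono by blast
  qed
qed

text \<open>\<open>klein_perp L\<close> has dimension 4, so \<open>q + 1\<close> planes lie between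
  \<open>L\<close> and it; by \<open>Int_klein_cone_eq_line_iff\<close> the nonsingular ones are
  those counted, and just \<open>U\<close> and \<open>V\<close> are removed.\<close>

lemma card_tangent_planes_through_line:
  fixes U V L :: "('a::{field,finite}^6) set"
  assumes U: "vec.subspace U" "vec.dim U = 3" "U \<subseteq> klein_cone" "L \<subseteq> U"
    and V: "vec.subspace V" "vec.dim V = 3" "V \<subseteq> klein_cone" "L \<subseteq> V"
    and L: "vec.subspace L" "vec.dim L = 2"
    and "U \<noteq> V"
    and only: "\<And>W. vec.subspace W \<Longrightarrow> vec.dim W = 3 \<Longrightarrow> W \<subseteq> klein_cone \<Longrightarrow> L \<subseteq> W \<Longrightarrow> W = U \<or> W = V"
  shows "card {W. vec.subspace W \<and> vec.dim W = 3 \<and> W \<inter> klein_cone = L} = CARD('a) - 1"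
proof -
  let ?F = "{W. vec.subspace W \<and> L \<subseteq> W \<and> W \<subseteq> klein_perp L \<and> vec.dim W = vec.dim L + 1}"
  have LC: "L \<subseteq> klein_cone" using U by blast
  have perp: "W \<subseteq> klein_perp L" if "vec.subspace W" "W \<subseteq> klein_cone" "L \<subseteq> W" for W
    using that subset_klein_perp_if_singular klein_perp_antimono by blast
  have "{W. vec.subspace W \<and> vec.dim W = 3 \<and> W \<inter> klein_cone = L} = ?F - {U, V}"
  proof (intro equalityI subsetI)
    fix W assume "W \<in> {W. vec.subspace W \<and> vec.dim W = 3 \<and> W \<inter> klein_cone = L}"
    then have W: "vec.subspace W" "vec.dim W = 3" "W \<inter> klein_cone = L" by auto
    then show "W \<in> ?F - {U, V}"
      using Int_klein_cone_eq_line_iff[OF W(1,2) L _ LC] U V L by auto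
  next
    fix W assume "W \<in> ?F - {U, V}"
    then have W: "vec.subspace W" "vec.dim W = 3" "L \<subseteq> W" "W \<subseteq> klein_perp L" "W \<noteq> U" "W \<noteq> V"
      using L by auto
    then show "W \<in> {W. vec.subspace W \<and> vec.dim W = 3 \<and> W \<inter> klein_cone = L}"
      using Int_klein_cone_eq_line_iff[OF W(1,2) L W(3) LC] only by auto
  qed
  moreover have "U \<in> ?F" "V \<in> ?F" using U V L perp by auto
  moreover have "card ?F = CARD('a) + 1"
    using L perp[OF L(1) LC] dim_klein_perp[OF L(1)]
    by (intro card_subspaces_between_2 subspace_klein_perp) auto
  ultimately show ?thesis using \<open>U \<noteq> V\<close> by (simp add: card_Diff_subset)
qed

text \<open>With \<open>A\<close> spanned by \<open>P\<close> and \<open>x\<close>, and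
  \<open>B\<close> by \<open>P\<close> and \<open>y\<close>, a vector of the span is
  \<open>p + k *s y + a *s x\<close> with \<open>p\<close> in \<open>P\<close>, and its form is
  \<open>a * k * klein_bilin x y\<close>. As the polar value is nonzero, the singular vectors are
  those with \<open>a = 0\<close> or \<open>k = 0\<close>, which make up \<open>B\<close> and
  \<open>A\<close>. The last claim holds because \<open>x\<close> is orthogonal to \<open>L\<close>
  but lies outside \<open>U\<close>.\<close>

lemma span_two_lines:
  fixes U V L P A B :: "('a::field^6) set"
  assumes U: "vec.subspace U" "vec.dim U = 3" "U \<subseteq> klein_cone"
    and V: "vec.subspace V" "vec.dim V = 3" "V \<subseteq> klein_cone"
    and L: "L = U \<inter> V" "vec.dim L = 2"
    and P: "vec.subspace P" "vec.dim P = 1"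
    and A: "vec.subspace A" "vec.dim A = 2" "P \<subseteq> A" "A \<subseteq> V" "A \<noteq> L"
    and B: "vec.subspace B" "vec.dim B = 2" "P \<subseteq> B" "B \<subseteq> U" "B \<noteq> L"
  shows "vec.dim (vec.span (A \<union> B)) = 3"
    and "vec.span (A \<union> B) \<inter> klein_cone = A \<union> B"
    and "vec.span (A \<union> B) \<inter> U = B"
    and "A \<inter> B = P"
    and "R \<subseteq> U \<Longrightarrow> vec.span (A \<union> B) \<subseteq> klein_perp R \<longleftrightarrow> R \<subseteq> L"
proof -
  have subL: "vec.subspace L" using L U V by (simp add: vec.subspace_inter)
  have ne: "A \<noteq> P" "B \<noteq> P" using A B P by auto
  obtain x where x: "x \<in> A" "x \<notin> P" using ne A(3) by auto
  obtain y where y: "y \<in> B" "y \<notin> P" using ne B(3) by auto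
  have A_eq: "A = vec.span (insert x P)" using A P x by (intro subspace_eq_span_insert) auto
  have B_eq: "B = vec.span (insert y P)" using B P y by (intro subspace_eq_span_insert) auto
  have PL: "P \<subseteq> L" using A B L by auto
  have "x \<notin> L"
  proof
    assume "x \<in> L"
    then have "A \<subseteq> L" unfolding A_eq using PL subL by (intro vec.span_minimal) auto
    then show False using A L subL subspace_eq_if_dim by metis
  qed
  then have xU: "x \<notin> U" using x A L by auto
  have yL: "y \<notin> L"
  proof
    assume "y \<in> L"
    then have "B \<subseteq> L" unfolding B_eq using PL subL by (intro vec.span_minimal) auto
    then show False using B L subL subspace_eq_if_dim by metis
  qed
  have perpV: "klein_perp V = V" and perpU: "klein_perp U = U"
    using U V by (simp_all add: klein_perp_singular_plane)
  have xL: "x \<in> klein_perp L"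
    using klein_perp_antimono[of L V] perpV x A L by blast
  \<comment> \<open>Otherwise \<open>x\<close> would be orthogonal to \<open>L\<close> and to
    \<open>y\<close>, hence to \<open>U\<close>, and so lie in \<open>U\<close>.\<close>
  have xy: "klein_bilin x y \<noteq> 0"
  proof
    assume "klein_bilin x y = 0"
    then have "x \<in> klein_perp {y}" by (simp add: klein_perp_def klein_bilin_commute)
    then show False
      using klein_perp_line_point[OF U subL L(2), of "{y}" x] xL yL y B L xU by auto
  qed
  \<comment> \<open>The part of the \<open>A\<close> summand in \<open>P\<close> is absorbed into
    \<open>B\<close>, so that only the coefficient of \<open>x\<close> remains.\<close>
  have W_elem: "\<exists>a b. b \<in> B \<and> w = a *s x + b" if "w \<in> vec.span (A \<union> B)" for w
  proof -
    obtain u b where u: "u \<in> A" "b \<in> B" "w = u + b"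
      using \<open>w \<in> _\<close> A B by (auto simp: vec.span_Un vec.span_eq_iff[THEN iffD2])
    obtain k where "u - k *s x \<in> P"
      using u(1) P unfolding A_eq by (auto simp: vec.span_insert vec.span_eq_iff[THEN iffD2])
    then have "(u - k *s x) + b \<in> B" using u B by (blast intro: vec.subspace_add)
    then show ?thesis using u(3) by (intro exI[of _ k] exI[of _ "(u - k *s x) + b"]) auto
  qed
  show WU: "vec.span (A \<union> B) \<inter> U = B"
  proof (intro equalityI subsetI)
    fix w assume w: "w \<in> vec.span (A \<union> B) \<inter> U"
    then obtain a b where ab: "b \<in> B" "w = a *s x + b" using W_elem by blast
    then have "w - b \<in> U" using w B U by (blast intro: vec.subspace_diff)
    then have "a *s x \<in> U" using ab by simp
    then have "inverse a *s (a *s x) \<in> U" using U by (blast intro: vec.subspace_scale)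
    then have "a = 0" using xU by (cases "a = 0") (auto simp: vector_smult_assoc)
    then show "w \<in> B" using ab by simp
  qed (use B in \<open>auto intro: vec.span_base\<close>)
  show "A \<inter> B = P"
  proof (rule ccontr)
    assume "A \<inter> B \<noteq> P"
    \<comment> \<open>A common vector outside \<open>P\<close> would make the two lines equal, but
      \<open>x\<close> is not in \<open>U\<close>.\<close>
    then obtain z where z: "z \<in> A" "z \<in> B" "z \<notin> P" using A B by auto
    then have "A = vec.span (insert z P)" "B = vec.span (insert z P)"
      using A B P by (simp_all add: subspace_eq_span_insert)
    then show False using x xU B by auto
  qed
  show "vec.span (A \<union> B) \<inter> klein_cone = A \<union> B"
  proof (intro equalityI subsetI)
    fix w assume w: "w \<in> vec.span (A \<union> B) \<inter> klein_cone"
    then obtain a b where ab: "b \<in> B" "w = a *s x + b" using W_elem by blast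
    obtain k where k: "b - k *s y \<in> P"
      using ab(1) P unfolding B_eq by (auto simp: vec.span_insert vec.span_eq_iff[THEN iffD2])
    \<comment> \<open>\<open>P\<close> lies in \<open>L\<close>, which is orthogonal to
      \<open>x\<close>, so only the \<open>y\<close> part of \<open>b\<close> contributes.\<close>
    have "klein_bilin (b - k *s y) x = 0"
      using k PL xL by (auto simp: klein_perp_def simp del: klein_bilin_simps)
    then have "klein_bilin x b = k * klein_bilin x y"
      by (simp add: klein_bilin_commute[of b] klein_bilin_commute[of y])
    moreover have "klein_form x = 0" "klein_form b = 0"
      using x A V ab B U by (auto simp: klein_cone_def)
    ultimately have "klein_form w = a * k * klein_bilin x y"
      using ab by (simp add: klein_form_add)
    then have "a = 0 \<or> k = 0" using w xy by (auto simp: klein_cone_def)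
    then show "w \<in> A \<union> B"
    proof
      assume "k = 0"
      then have "b \<in> A" using k A by auto
      then have "w \<in> A" using ab x A by (auto intro: vec.subspace_add vec.subspace_scale)
      then show ?thesis by simp
    qed (use ab in simp)
  qed (use A B U V in \<open>auto intro: vec.span_base\<close>)
  have "vec.span (A \<union> B) = vec.span (insert x B)"
  proof
    have "A \<subseteq> vec.span (insert x B)"
      unfolding A_eq using B by (intro vec.span_mono) auto
    then show "vec.span (A \<union> B) \<subseteq> vec.span (insert x B)"
      by (intro vec.span_minimal) (auto intro: vec.span_base)
  qed (use x in \<open>auto intro!: vec.span_mono\<close>)
  then show "vec.dim (vec.span (A \<union> B)) = 3"
    using B xU by (auto simp: vec.dim_insert vec.span_eq_iff[THEN iffD2])
  show "vec.span (A \<union> B) \<subseteq> klein_perp R \<longleftrightarrow> R \<subseteq> L" if R: "R \<subseteq> U"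
  proof
    assume "vec.span (A \<union> B) \<subseteq> klein_perp R"
    then have "x \<in> klein_perp R" using x by (auto intro: vec.span_base)
    then show "R \<subseteq> L"
      using klein_perp_line_point[OF U subL L(2) _ R] xL xU L by blast
  next
    assume RL: "R \<subseteq> L"
    then have "V \<subseteq> klein_perp R" "U \<subseteq> klein_perp R"
      using klein_perp_antimono[of R V] klein_perp_antimono[of R U] perpV perpU L by blast+
    then show "vec.span (A \<union> B) \<subseteq> klein_perp R"
      using A B by (intro vec.span_minimal subspace_klein_perp) auto
  qed
qed

subsection \<open>Projective subspaces and projectivities\<close>

text \<open>The vector sets treated as determined by their points. Besides subspaces this covers the
  singular cone and unions of two subspaces, which occur as plane sections.\<close>

definition scaling_closed :: "('a::field^'n) set \<Rightarrow> bool" where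
  "scaling_closed K \<longleftrightarrow> 0 \<in> K \<and> (\<forall>c. \<forall>x\<in>K. c *s x \<in> K)"

lemma scaling_closed_subspace: "vec.subspace U \<Longrightarrow> scaling_closed U"
  by (auto simp: scaling_closed_def vec.subspace_def)

lemma scaling_closed_Un: "scaling_closed K \<Longrightarrow> scaling_closed K' \<Longrightarrow> scaling_closed (K \<union> K')"
  by (auto simp: scaling_closed_def)

lemma scaling_closed_Int: "scaling_closed K \<Longrightarrow> scaling_closed K' \<Longrightarrow> scaling_closed (K \<inter> K')"
  by (auto simp: scaling_closed_def)

lemma scaling_closed_klein_cone: "scaling_closed klein_cone"
  by (auto simp: scaling_closed_def klein_cone_def)

lemmas scaling_closed_intros = scaling_closed_subspace scaling_closed_Un scaling_closed_Int
  scaling_closed_klein_cone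

lemma span_singleton_in_points_of:
  fixes K :: "('a::field^'n) set"
  assumes "scaling_closed K" "x \<in> K" "x \<noteq> 0"
  shows "vec.span {x} \<in> points_of K"
proof -
  have "vec.span {x} \<subseteq> K"
    using assms by (auto simp: scaling_closed_def vec.span_singleton)
  then show ?thesis using assms(3) by (simp add: points_of_def pg_points_def)
qed

text \<open>Every nonzero vector of \<open>K\<close> spans a point of \<open>K\<close>, and zero is
  in both sets.\<close>

lemma points_of_subset_iff:
  fixes K :: "('a::field^'n) set"
  assumes K: "scaling_closed K" and K': "scaling_closed K'"
  shows "points_of K \<subseteq> points_of K' \<longleftrightarrow> K \<subseteq> K'"
proof
  assume sub: "points_of K \<subseteq> points_of K'"
  show "K \<subseteq> K'"
  proof
    fix x assume x: "x \<in> K"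
    show "x \<in> K'"
    proof (cases "x = 0")
      case False
      then have "vec.span {x} \<subseteq> K'"
        using span_singleton_in_points_of[OF K x] sub by (auto simp: points_of_def)
      then show ?thesis using vec.span_base[of x "{x}"] by auto
    qed (use K' in \<open>simp add: scaling_closed_def\<close>)
  qed
qed (auto simp: points_of_def)

lemma points_of_eq_iff:
  fixes K :: "('a::field^'n) set"
  assumes "scaling_closed K" "scaling_closed K'"
  shows "points_of K = points_of K' \<longleftrightarrow> K = K'"
  using points_of_subset_iff[OF assms] points_of_subset_iff[OF assms(2,1)] by auto

lemma points_of_Int: "points_of K \<inter> points_of K' = points_of (K \<inter> K')"
  by (auto simp: points_of_def)

lemma points_of_mono: "K \<subseteq> K' \<Longrightarrow> points_of K \<subseteq> points_of K'"
  by (auto simp: points_of_def)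

lemma points_of_point: "P \<in> pg_points \<Longrightarrow> points_of P = {P}"
  using subspace_eq_if_dim by (fastforce simp: points_of_def pg_points_def)

lemma mem_points_of: "P \<in> points_of K \<longleftrightarrow> P \<in> pg_points \<and> P \<subseteq> K"
  by (simp add: points_of_def)

text \<open>Positive dimension excludes the zero space, which has no points although it contains the
  zero vector.\<close>

lemma Union_points_of:
  fixes U :: "('a::field^'n) set"
  assumes U: "vec.subspace U" "vec.dim U > 0"
  shows "\<Union>(points_of U) = U"
proof
  have "\<not> U \<subseteq> {0}"
  proof
    assume "U \<subseteq> {0}"
    then have "vec.dim U = 0" by (rule vec.dim_eq_0[THEN iffD2])
    then show False using U(2) by (simp only: less_irrefl)
  qed
  then obtain y where y: "y \<in> U" "y \<noteq> 0" by auto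
  show "U \<subseteq> \<Union>(points_of U)"
  proof
    fix x assume x: "x \<in> U"
    show "x \<in> \<Union>(points_of U)"
    proof (cases "x = 0")
      case True
      then show ?thesis
        using span_singleton_in_points_of[OF scaling_closed_subspace[OF U(1)] y] vec.span_zero by blast
    next
      case False
      then show ?thesis
        using span_singleton_in_points_of[OF scaling_closed_subspace[OF U(1)] x]
          vec.span_base[of x "{x}"] by blast
    qed
  qed
qed (auto simp: points_of_def)

text \<open>A point is spanned by any of its nonzero vectors, so it lies wholly in a subspace that
  contains one of them.\<close>

lemma points_of_Un:
  fixes A B :: "('a::field^'n) set"
  assumes A: "vec.subspace A" and B: "vec.subspace B"
  shows "points_of (A \<union> B) = points_of A \<union> points_of B"
proof
  show "points_of (A \<union> B) \<subseteq> points_of A \<union> points_of B"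
  proof
    fix p assume "p \<in> points_of (A \<union> B)"
    then have p: "p \<in> pg_points" "p \<subseteq> A \<union> B" by (auto simp: points_of_def)
    then have "\<not> p \<subseteq> {0}" using vec.dim_eq_0[of p] by (simp add: pg_points_def)
    then obtain x where x: "x \<in> p" "x \<noteq> 0" by auto
    have "vec.span {x} \<in> points_of p"
      using p x by (intro span_singleton_in_points_of scaling_closed_subspace) (auto simp: pg_points_def)
    then have "p = vec.span {x}" using points_of_point p(1) by auto
    moreover have "vec.span {x} \<in> points_of A" if "x \<in> A"
      using that x A by (intro span_singleton_in_points_of scaling_closed_subspace)
    moreover have "vec.span {x} \<in> points_of B" if "x \<in> B"
      using that x B by (intro span_singleton_in_points_of scaling_closed_subspace)
    ultimately show "p \<in> points_of A \<union> points_of B" using x p by auto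
  qed
qed (auto simp: points_of_def)

lemma pg_subspacesE:
  assumes "\<tau> \<in> pg_subspaces k"
  obtains U where "vec.subspace U" "vec.dim U = k + 1" "\<tau> = points_of U"
  using assms by (auto simp: pg_subspaces_def)

lemma points_of_in_pg_subspaces_iff:
  fixes U :: "('a::field^'n) set"
  assumes "vec.subspace U"
  shows "points_of U \<in> pg_subspaces k \<longleftrightarrow> vec.dim U = k + 1"
  using assms by (auto simp: pg_subspaces_def points_of_eq_iff scaling_closed_subspace)

lemma pg_subspaces_subset_points: "\<tau> \<in> pg_subspaces k \<Longrightarrow> \<tau> \<subseteq> pg_points"
  by (auto simp: pg_subspaces_def points_of_def)

lemma pg_subspaces_eq_if_subset:
  assumes "\<tau> \<in> pg_subspaces k" "\<tau>' \<in> pg_subspaces k" "\<tau> \<subseteq> \<tau>'"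
  shows "\<tau> = \<tau>'"
proof -
  obtain U where U: "vec.subspace U" "vec.dim U = k + 1" "\<tau> = points_of U"
    using assms(1) by (rule pg_subspacesE)
  obtain V where V: "vec.subspace V" "vec.dim V = k + 1" "\<tau>' = points_of V"
    using assms(2) by (rule pg_subspacesE)
  show ?thesis
    using assms(3) U V subspace_eq_if_dim[of U V]
    by (simp add: points_of_subset_iff scaling_closed_subspace)
qed

text \<open>\<open>points_of\<close> is injective on subspaces, so projective counts become counts
  of vector subspaces.\<close>

lemma card_pg_subspaces_Collect:
  fixes \<Phi> :: "('a::field^'n) set set \<Rightarrow> bool"
  shows "card {\<tau> \<in> pg_subspaces k. \<Phi> \<tau>}
    = card {U. vec.subspace U \<and> vec.dim U = k + 1 \<and> \<Phi> (points_of U)}"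
proof -
  have "{\<tau> \<in> pg_subspaces k. \<Phi> \<tau>}
      = points_of ` {U. vec.subspace U \<and> vec.dim U = k + 1 \<and> \<Phi> (points_of U)}"
    by (auto simp: pg_subspaces_def)
  moreover have "inj_on points_of {U :: ('a^'n) set. vec.subspace U \<and> vec.dim U = k + 1 \<and> \<Phi> (points_of U)}"
    by (auto simp: inj_on_def points_of_eq_iff scaling_closed_subspace)
  ultimately show ?thesis by (simp add: card_image)
qed

text \<open>A subspace with one point only is that point, of dimension 1. This separates the
  intersections within a family from those between the families.\<close>

lemma singleton_not_pg_line: "{p} \<notin> pg_lines"
proof
  assume "{p} \<in> pg_lines"
  then obtain U where U: "vec.subspace U" "vec.dim U = 2" "{p} = points_of U"
    by (auto elim: pg_subspacesE)
  then have p: "p \<in> pg_points" by (auto simp: points_of_def)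
  then have "p = U"
    using U points_of_point[OF p] points_of_eq_iff[of p U] by (auto simp: pg_points_def scaling_closed_subspace)
  then show False using p U by (simp add: pg_points_def)
qed

text \<open>In vector terms these are the spaces strictly between dimension 1 and dimension 3, so
  \<open>card_subspaces_between_2\<close> applies.\<close>

lemma card_pg_lines_through_point:
  fixes \<pi> :: "('a::{field,finite}^'n) set set"
  assumes \<pi>: "\<pi> \<in> pg_planes" and P: "P \<in> \<pi>"
  shows "card {m \<in> pg_lines. m \<subseteq> \<pi> \<and> P \<in> m} = CARD('a) + 1"
proof -
  obtain U where U: "vec.subspace U" "vec.dim U = 3" "\<pi> = points_of U"
    using \<pi> by (auto elim: pg_subspacesE)
  have P': "P \<in> pg_points" "vec.subspace P" "vec.dim P = 1" "P \<subseteq> U"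
    using P U by (auto simp: points_of_def pg_points_def)
  have sub: "points_of A \<subseteq> \<pi> \<longleftrightarrow> A \<subseteq> U" if "vec.subspace A" for A
    using U that by (simp add: points_of_subset_iff scaling_closed_subspace)
  have "card {m \<in> pg_lines. m \<subseteq> \<pi> \<and> P \<in> m}
      = card {A. vec.subspace A \<and> vec.dim A = 1 + 1 \<and> points_of A \<subseteq> \<pi> \<and> P \<in> points_of A}"
    by (rule card_pg_subspaces_Collect)
  also have "{A. vec.subspace A \<and> vec.dim A = 1 + 1 \<and> points_of A \<subseteq> \<pi> \<and> P \<in> points_of A}
      = {A. vec.subspace A \<and> P \<subseteq> A \<and> A \<subseteq> U \<and> vec.dim A = vec.dim P + 1}"
    using P' sub by (auto simp: mem_points_of)
  also have "card \<dots> = CARD('a) + 1"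
    using U P' by (intro card_subspaces_between_2) auto
  finally show ?thesis .
qed

lemma klein_quadric_eq: "klein_quadric = points_of klein_cone"
  by (auto simp: klein_quadric_def points_of_def klein_cone_def klein_form_def)

lemma points_of_subset_klein_quadric_iff:
  "vec.subspace U \<Longrightarrow> points_of U \<subseteq> klein_quadric \<longleftrightarrow> U \<subseteq> klein_cone"
  by (simp add: klein_quadric_eq points_of_subset_iff scaling_closed_intros)

lemma points_of_Int_klein_quadric_eq_iff:
  "vec.subspace U \<Longrightarrow> scaling_closed K \<Longrightarrow>
    points_of U \<inter> klein_quadric = points_of K \<longleftrightarrow> U \<inter> klein_cone = K"
  by (simp add: klein_quadric_eq points_of_Int points_of_eq_iff scaling_closed_intros)

section \<open>Action of projectivities on points, subspaces and spans\<close>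

lemma projectivity_apply: "p \<in> pg_points \<Longrightarrow> projectivity M p = (*v) M ` p"
  by (simp add: projectivity_def)

lemma inj_invertible: "invertible (M :: 'a::field^'n^'n) \<Longrightarrow> inj ((*v) M)"
  by (metis inj_on_inverseI invertible_def matrix_vector_mul_assoc matrix_vector_mul_lid)

lemma linear_mult_vec: "Vector_Spaces.linear (*s) (*s) ((*v) (M :: 'a::field^'n^'m))"
  by (rule matrix_vector_mul_linear_gen)

lemma subspace_image_mult_vec:
  "vec.subspace U \<Longrightarrow> vec.subspace ((*v) (M :: 'a::field^'n^'m) ` U)"
  by (rule linear_mult_vec[THEN vec.linear_subspace_image])

lemma dim_image_mult_vec:
  assumes "invertible (M :: 'a::field^'n^'n)"
  shows "vec.dim ((*v) M ` U) = vec.dim U"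
  using inj_invertible[OF assms] by (intro vec.dim_image_eq linear_mult_vec) (auto intro: inj_on_subset)

text \<open>The inverse matrix supplies the preimage of a point, since invertible matrices map
  points to points.\<close>

lemma projectivity_points_of:
  assumes M: "invertible (M :: 'a::field^'n^'n)"
  shows "projectivity M ` points_of K = points_of ((*v) M ` K)"
proof -
  obtain N where N: "N ** M = mat 1" "M ** N = mat 1" using M by (auto simp: invertible_def)
  then have N_inv: "invertible N" by (auto simp: invertible_def)
  have NM: "N *v (M *v x) = x" "M *v (N *v x) = x" for x
    using N by (simp_all add: matrix_vector_mul_assoc)
  have pts: "(*v) M' ` p \<in> pg_points" if "p \<in> pg_points" "invertible M'" for M' :: "'a^'n^'n" and p
    using that by (simp add: pg_points_def subspace_image_mult_vec dim_image_mult_vec)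
  show ?thesis
  proof (intro equalityI subsetI)
    fix p assume "p \<in> projectivity M ` points_of K"
    then show "p \<in> points_of ((*v) M ` K)"
      using M pts by (auto simp: points_of_def projectivity_apply)
  next
    fix p assume p: "p \<in> points_of ((*v) M ` K)"
    then have "(*v) N ` p \<in> points_of K"
      using pts[OF _ N_inv] NM by (auto simp: points_of_def subset_iff)
    moreover have "projectivity M ((*v) N ` p) = p"
      using calculation NM by (simp add: points_of_def projectivity_apply image_image)
    ultimately show "p \<in> projectivity M ` points_of K" by (metis imageI)
  qed
qed

lemma inj_on_projectivity:
  assumes "invertible (M :: 'a::field^'n^'n)"
  shows "inj_on (projectivity M) pg_points"
  using inj_invertible[OF assms] by (auto simp: inj_on_def projectivity_apply inj_image_eq_iff)

lemma projectivity_pg_subspaces: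
  assumes "invertible (M :: 'a::field^'n^'n)" "\<tau> \<in> pg_subspaces k"
  shows "projectivity M ` \<tau> \<in> pg_subspaces k"
  using assms by (auto elim!: pg_subspacesE simp: projectivity_points_of points_of_in_pg_subspaces_iff
      subspace_image_mult_vec dim_image_mult_vec)

text \<open>Surjectivity comes from the inverse matrix; it serves to pull lines back in
  \<open>two_line_planes_image\<close>.\<close>

lemma projectivity_pg_subspaces_eq:
  assumes M: "invertible (M :: 'a::field^'n^'n)"
  shows "(`) (projectivity M) ` pg_subspaces k = pg_subspaces k"
proof (intro equalityI subsetI)
  obtain N where N: "N ** M = mat 1" "M ** N = mat 1" using M by (auto simp: invertible_def)
  fix \<tau> :: "('a^'n) set set" assume "\<tau> \<in> pg_subspaces k"
  then obtain U where U: "vec.subspace U" "vec.dim U = k + 1" "\<tau> = points_of U"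
    by (rule pg_subspacesE)
  have "invertible N" using N by (auto simp: invertible_def)
  then have "points_of ((*v) N ` U) \<in> pg_subspaces k"
    using U by (simp add: points_of_in_pg_subspaces_iff subspace_image_mult_vec dim_image_mult_vec)
  moreover have "projectivity M ` points_of ((*v) N ` U) = \<tau>"
    using N by (simp add: projectivity_points_of M image_image matrix_vector_mul_assoc U)
  ultimately show "\<tau> \<in> (`) (projectivity M) ` pg_subspaces k" by blast
qed (use assms projectivity_pg_subspaces in blast)

text \<open>Matrix images commute with unions and with linear spans. The inclusion
  \<open>A \<subseteq> pg_points\<close> keeps \<open>A\<close> in the domain of the restricted
  function \<open>projectivity M\<close>.\<close>

lemma projectivity_pg_span:
  assumes M: "invertible (M :: 'a::field^'n^'n)" and A: "A \<subseteq> pg_points"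
  shows "projectivity M ` pg_span A = pg_span (projectivity M ` A)"
proof -
  have "\<Union>(projectivity M ` A) = (*v) M ` (\<Union>A)"
    using A by (auto simp: projectivity_apply subset_iff)
  then show ?thesis
    by (simp add: pg_span_def projectivity_points_of M vec.linear_span_image linear_mult_vec)
qed

section \<open>Plane sections in projective form\<close>

lemma pg_span_points_of_Un:
  fixes A B :: "('a::field^'n) set"
  assumes "vec.subspace A" "vec.subspace B" "vec.dim A > 0" "vec.dim B > 0"
  shows "pg_span (points_of A \<union> points_of B) = points_of (vec.span (A \<union> B))"
  using assms by (simp add: pg_span_def Union_points_of)

text \<open>Otherwise take a vector of \<open>D\<close> missing from each; their sum lies in neither
  subspace.\<close>

lemma subspace_subset_Un:
  fixes A B D :: "('a::field^'n) set"
  assumes "vec.subspace A" "vec.subspace B" "vec.subspace D" "D \<subseteq> A \<union> B"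
  shows "D \<subseteq> A \<or> D \<subseteq> B"
proof (rule ccontr)
  assume "\<not> ?thesis"
  then obtain x y where xy: "x \<in> D" "x \<notin> A" "y \<in> D" "y \<notin> B" by auto
  then have "x \<in> B" "y \<in> A" "x + y \<in> A \<union> B" using assms by (auto intro: vec.subspace_add)
  then show False
    using xy assms vec.subspace_diff[of A "x + y" y] vec.subspace_diff[of B "x + y" x] by auto
qed

text \<open>A line covered by \<open>m1 \<union> m2\<close> equals one of the two, and
  \<open>m1' \<noteq> m2\<close> leaves \<open>m1\<close>. This recovers one line of a section once
  the other is known.\<close>

lemma pg_line_unique_in_pair:
  fixes m1 m1' m2 :: "('a::field^'n) set set"
  assumes m: "m1 \<in> pg_lines" "m1' \<in> pg_lines" "m2 \<in> pg_lines"
    and eq: "m1 \<union> m2 = m1' \<union> m2" and ne: "m1' \<noteq> m2"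
  shows "m1 = m1'"
proof -
  obtain A where A: "vec.subspace A" "vec.dim A = 2" "m1 = points_of A"
    using m by (auto elim: pg_subspacesE)
  obtain A' where A': "vec.subspace A'" "vec.dim A' = 2" "m1' = points_of A'"
    using m by (auto elim: pg_subspacesE)
  obtain B where B: "vec.subspace B" "vec.dim B = 2" "m2 = points_of B"
    using m by (auto elim: pg_subspacesE)
  have "A \<union> B = A' \<union> B"
    using eq A A' B
    by (simp add: points_of_Un[symmetric] points_of_eq_iff scaling_closed_intros)
  then have "A' \<subseteq> A \<or> A' \<subseteq> B" using A A' B by (intro subspace_subset_Un) auto
  then show ?thesis
    using subspace_eq_if_dim[of A' A] subspace_eq_if_dim[of A' B] A A' B ne by auto
qed

lemma pg_span_two_lines:
  fixes g \<pi> l m1 m2 :: "('a::field^6) set set"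
  assumes g: "g \<in> pg_planes" "g \<subseteq> klein_quadric"
    and \<pi>: "\<pi> \<in> pg_planes" "\<pi> \<subseteq> klein_quadric"
    and l: "l = g \<inter> \<pi>" "l \<in> pg_lines"
    and m1: "m1 \<in> pg_lines" "P \<in> m1" "m1 \<subseteq> \<pi>" "m1 \<noteq> l"
    and m2: "m2 \<in> pg_lines" "P \<in> m2" "m2 \<subseteq> g" "m2 \<noteq> l"
  shows "pg_span (m1 \<union> m2) \<in> pg_planes"
    and "pg_span (m1 \<union> m2) \<inter> klein_quadric = m1 \<union> m2"
    and "pg_span (m1 \<union> m2) \<inter> g = m2"
    and "m1 \<inter> m2 = {P}"
    and "R \<in> g \<Longrightarrow> pg_span (m1 \<union> m2) \<subseteq> points_of (klein_perp R) \<longleftrightarrow> R \<in> l"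
proof -
  obtain U where U: "vec.subspace U" "vec.dim U = 3" "g = points_of U"
    by (rule pg_subspacesE[OF g(1)]) simp
  obtain V where V: "vec.subspace V" "vec.dim V = 3" "\<pi> = points_of V"
    by (rule pg_subspacesE[OF \<pi>(1)]) simp
  obtain A where A: "vec.subspace A" "vec.dim A = 2" "m1 = points_of A"
    by (rule pg_subspacesE[OF m1(1)]) simp
  obtain B where B: "vec.subspace B" "vec.dim B = 2" "m2 = points_of B"
    by (rule pg_subspacesE[OF m2(1)]) simp
  define L where "L = U \<inter> V"
  have L: "vec.subspace L" "l = points_of L"
    using U V l by (simp_all add: L_def vec.subspace_inter points_of_Int)
  have dimL: "vec.dim L = 2" using l(2) points_of_in_pg_subspaces_iff[OF L(1), of 1] by (simp add: L(2))
  have P: "vec.subspace P" "vec.dim P = 1" "P \<in> pg_points" "P \<subseteq> A" "P \<subseteq> B"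
    using m1 m2 A B by (auto simp: points_of_def pg_points_def)
  have UC: "U \<subseteq> klein_cone" "V \<subseteq> klein_cone"
    using g \<pi> U V by (simp_all add: points_of_subset_klein_quadric_iff)
  have AB: "A \<subseteq> V" "A \<noteq> L" "B \<subseteq> U" "B \<noteq> L"
    using m1 m2 A B U V L by (auto simp: points_of_subset_iff scaling_closed_subspace)
  note span = span_two_lines[OF U(1,2) UC(1) V(1,2) UC(2) L_def dimL P(1,2) A(1,2) P(4) AB(1,2)
      B(1,2) P(5) AB(3,4)]
  have W: "pg_span (m1 \<union> m2) = points_of (vec.span (A \<union> B))"
    using A B by (simp add: pg_span_points_of_Un)
  show "pg_span (m1 \<union> m2) \<in> pg_planes"
    using span(1) by (simp add: W points_of_in_pg_subspaces_iff)
  show "pg_span (m1 \<union> m2) \<inter> klein_quadric = m1 \<union> m2"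
    unfolding W klein_quadric_eq points_of_Int span(2) using A B by (simp add: points_of_Un)
  show "pg_span (m1 \<union> m2) \<inter> g = m2"
    unfolding W U(3) points_of_Int span(3) by (simp add: B)
  show "m1 \<inter> m2 = {P}"
    using span(4) P by (simp add: A B points_of_Int points_of_point)
  show "pg_span (m1 \<union> m2) \<subseteq> points_of (klein_perp R) \<longleftrightarrow> R \<in> l" if "R \<in> g"
    using span(5)[of R] that
    by (auto simp: W U L points_of_subset_iff scaling_closed_subspace subspace_klein_perp mem_points_of)
qed

lemma pg_line_not_subset_singleton:
  assumes "m \<in> pg_lines"
  shows "\<not> m \<subseteq> {p}"
proof
  assume "m \<subseteq> {p}"
  then have "m = {} \<or> m = {p}" by auto
  moreover have "m \<noteq> {}"
  proof
    assume "m = {}"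
    obtain U where U: "vec.subspace U" "vec.dim U = 2" "m = points_of U"
      by (rule pg_subspacesE[OF assms]) simp
    then have "U = {}" using Union_points_of[of U] \<open>m = {}\<close> by simp
    then show False using vec.subspace_0[OF U(1)] by simp
  qed
  ultimately show False using assms singleton_not_pg_line by metis
qed

text \<open>Orthogonality is symmetric, and a singular plane is its own perpendicular space.\<close>

lemma singular_plane_subset_klein_perp_iff:
  assumes h: "h \<in> pg_planes" "h \<subseteq> klein_quadric" and R: "R \<in> pg_points"
  shows "h \<subseteq> points_of (klein_perp R) \<longleftrightarrow> R \<in> h"
proof -
  obtain U where U: "vec.subspace U" "vec.dim U = 3" "h = points_of U"
    by (rule pg_subspacesE[OF h(1)]) simp
  have "klein_perp U = U"
    using U h by (simp add: klein_perp_singular_plane points_of_subset_klein_quadric_iff)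
  then show ?thesis
    using R U klein_perp_galois[of U R]
    by (simp add: points_of_subset_iff scaling_closed_subspace subspace_klein_perp mem_points_of)
qed

lemma tangent_plane_subset_points_of_klein_perp_iff:
  assumes g: "g \<in> pg_planes" "g \<subseteq> klein_quadric" and m: "m \<in> pg_lines" "m \<subseteq> g"
    and \<tau>: "\<tau> \<in> pg_planes" "\<tau> \<inter> klein_quadric = m" and R: "R \<in> g"
  shows "\<tau> \<subseteq> points_of (klein_perp R) \<longleftrightarrow> R \<in> m"
proof -
  obtain U where U: "vec.subspace U" "vec.dim U = 3" "g = points_of U"
    by (rule pg_subspacesE[OF g(1)]) simp
  obtain L where L: "vec.subspace L" "vec.dim L = 2" "m = points_of L"
    by (rule pg_subspacesE[OF m(1)]) simp
  obtain W where W: "vec.subspace W" "vec.dim W = 3" "\<tau> = points_of W"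
    by (rule pg_subspacesE[OF \<tau>(1)]) simp
  have "U \<subseteq> klein_cone" using g U by (simp add: points_of_subset_klein_quadric_iff)
  moreover have "L \<subseteq> U" using m U L by (simp add: points_of_subset_iff scaling_closed_subspace)
  moreover have "R \<subseteq> U" "R \<in> pg_points" using R U by (simp_all add: mem_points_of)
  moreover have "W \<inter> klein_cone = L"
    using \<tau>(2) W L by (simp add: points_of_Int_klein_quadric_eq_iff scaling_closed_subspace)
  ultimately show ?thesis
    using tangent_plane_subset_klein_perp_iff[of U L R W] U L W
    by (simp add: points_of_subset_iff scaling_closed_subspace subspace_klein_perp mem_points_of)
qed

text \<open>The assumption \<open>only\<close> is what the two families will supply:
  \<open>g\<close> and \<open>\<pi>\<close> are all the singular planes through
  \<open>m\<close>.\<close>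

lemma card_tangent_planes_through_pg_line:
  fixes g \<pi> m :: "('a::{field,finite}^6) set set"
  assumes g: "g \<in> pg_planes" "g \<subseteq> klein_quadric" "m \<subseteq> g"
    and \<pi>: "\<pi> \<in> pg_planes" "\<pi> \<subseteq> klein_quadric" "m \<subseteq> \<pi>"
    and m: "m \<in> pg_lines" and ne: "g \<noteq> \<pi>"
    and only: "\<And>\<tau>. \<tau> \<in> pg_planes \<Longrightarrow> \<tau> \<subseteq> klein_quadric \<Longrightarrow> m \<subseteq> \<tau> \<Longrightarrow> \<tau> = g \<or> \<tau> = \<pi>"
  shows "card {\<tau> \<in> pg_planes. \<tau> \<inter> klein_quadric = m} = CARD('a) - 1"
proof -
  obtain U where U: "vec.subspace U" "vec.dim U = 3" "g = points_of U"
    by (rule pg_subspacesE[OF g(1)]) simp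
  obtain V where V: "vec.subspace V" "vec.dim V = 3" "\<pi> = points_of V"
    by (rule pg_subspacesE[OF \<pi>(1)]) simp
  obtain L where L: "vec.subspace L" "vec.dim L = 2" "m = points_of L"
    by (rule pg_subspacesE[OF m(1)]) simp
  have "card {\<tau> \<in> pg_planes. \<tau> \<inter> klein_quadric = m}
      = card {W. vec.subspace W \<and> vec.dim W = 2 + 1 \<and> points_of W \<inter> klein_quadric = m}"
    by (rule card_pg_subspaces_Collect)
  also have "{W. vec.subspace W \<and> vec.dim W = 2 + 1 \<and> points_of W \<inter> klein_quadric = m}
      = {W. vec.subspace W \<and> vec.dim W = 3 \<and> W \<inter> klein_cone = L}"
    using points_of_Int_klein_quadric_eq_iff[OF _ scaling_closed_subspace[OF L(1)]]
    unfolding L(3) by (simp cong: conj_cong)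
  also have "card \<dots> = CARD('a) - 1"
  proof (rule card_tangent_planes_through_line[of U L V])
    fix W :: "('a^6) set"
    assume W: "vec.subspace W" "vec.dim W = 3" "W \<subseteq> klein_cone" "L \<subseteq> W"
    then have "points_of W = g \<or> points_of W = \<pi>"
      using L by (intro only)
        (simp_all add: points_of_in_pg_subspaces_iff points_of_subset_klein_quadric_iff points_of_mono)
    then show "W = U \<or> W = V"
      using U V W by (simp add: points_of_eq_iff scaling_closed_subspace)
  qed (use g \<pi> m ne U V L in \<open>auto simp: points_of_subset_klein_quadric_iff points_of_subset_iff
      scaling_closed_subspace\<close>)
  finally show ?thesis .
qed

lemma pg5_hyperplane_klein_perp:
  assumes "R \<in> pg_points"
  shows "points_of (klein_perp R) \<in> pg5_hyperplanes"
  using assms dim_klein_perp[of R]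
  by (simp add: points_of_in_pg_subspaces_iff subspace_klein_perp pg_points_def)

text \<open>Two vector spaces of dimension 3 in one of dimension 5 share a nonzero vector, which
  spans a common point.\<close>

lemma pg5_planes_in_hyperplane_meet:
  fixes \<tau> g :: "('a::{field,finite}^6) set set"
  assumes \<tau>: "\<tau> \<in> pg_planes" "\<tau> \<subseteq> \<Gamma>" and g: "g \<in> pg_planes" "g \<subseteq> \<Gamma>"
    and \<Gamma>: "\<Gamma> \<in> pg5_hyperplanes"
  shows "\<tau> \<inter> g \<noteq> {}"
proof -
  obtain U where U: "vec.subspace U" "vec.dim U = 3" "g = points_of U"
    by (rule pg_subspacesE[OF g(1)]) simp
  obtain W where W: "vec.subspace W" "vec.dim W = 3" "\<tau> = points_of W"
    by (rule pg_subspacesE[OF \<tau>(1)]) simp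
  obtain H where H: "vec.subspace H" "vec.dim H = 5" "\<Gamma> = points_of H"
    by (rule pg_subspacesE[OF \<Gamma>]) simp
  have "W \<subseteq> H" "U \<subseteq> H"
    using \<tau> g U W H by (simp_all add: points_of_subset_iff scaling_closed_subspace)
  then obtain x where x: "x \<in> W" "x \<in> U" "x \<noteq> 0"
    using Int_nontrivial_if_dim[of W U H] U W H by auto
  then have "vec.span {x} \<in> points_of (W \<inter> U)"
    using U W by (intro span_singleton_in_points_of scaling_closed_intros) auto
  then show ?thesis using U W by (auto simp: points_of_Int[symmetric])
qed

section \<open>The planes spanned by two lines through a point\<close>

definition two_line_planes ::
    "('a::field^'n) set set \<Rightarrow> ('a^'n) set set \<Rightarrow> ('a^'n) set set \<Rightarrow> ('a^'n) set \<Rightarrow> ('a^'n) set set set" where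
  "two_line_planes g \<pi> l P = {pg_span (m1 \<union> m2) | m1 m2.
     m1 \<in> pg_lines \<and> m1 \<subseteq> \<pi> \<and> P \<in> m1 \<and> m1 \<noteq> l \<and>
     m2 \<in> pg_lines \<and> m2 \<subseteq> g \<and> P \<in> m2 \<and> m2 \<noteq> l}"

lemma two_line_planesI:
  assumes "m1 \<in> pg_lines" "m1 \<subseteq> \<pi>" "P \<in> m1" "m1 \<noteq> l"
    and "m2 \<in> pg_lines" "m2 \<subseteq> g" "P \<in> m2" "m2 \<noteq> l"
  shows "pg_span (m1 \<union> m2) \<in> two_line_planes g \<pi> l P"
  unfolding two_line_planes_def using assms by blast

lemma two_line_planes_cases:
  assumes "\<tau> \<in> two_line_planes g \<pi> l P"
  obtains m1 m2 where "m1 \<in> pg_lines" "m1 \<subseteq> \<pi>" "P \<in> m1" "m1 \<noteq> l"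
    "m2 \<in> pg_lines" "m2 \<subseteq> g" "P \<in> m2" "m2 \<noteq> l" "\<tau> = pg_span (m1 \<union> m2)"
  using assms unfolding two_line_planes_def by blast

text \<open>Projectivities preserve lines, incidence and spans, so the image is the same
  construction from moved data; facts about \<open>two_line_planes\<close> then apply to every image
  under the Singer group.\<close>

lemma two_line_planes_image:
  assumes M: "invertible (M :: 'a::field^'n^'n)" and c: "c = projectivity M"
    and g: "g \<subseteq> pg_points" and \<pi>: "\<pi> \<subseteq> pg_points" and l: "l \<subseteq> pg_points" and P: "P \<in> pg_points"
  shows "(`) c ` two_line_planes g \<pi> l P = two_line_planes (c ` g) (c ` \<pi>) (c ` l) (c P)"
proof -
  have inj: "inj_on c pg_points" using M c by (simp add: inj_on_projectivity)
  note pts = pg_subspaces_subset_points[of _ 1]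
  have sub: "c ` m \<subseteq> c ` A \<longleftrightarrow> m \<subseteq> A" if "m \<in> pg_lines" "A \<subseteq> pg_points" for m A
    using inj_on_image_subset_iff[OF inj pts[OF that(1)] that(2)] .
  have eq: "c ` m = c ` l \<longleftrightarrow> m = l" if "m \<in> pg_lines" for m
    using inj_on_image_eq_iff[OF inj pts[OF that] l] .
  have mem: "c P \<in> c ` m \<longleftrightarrow> P \<in> m" if "m \<in> pg_lines" for m
    using inj_on_image_mem_iff[OF inj P pts[OF that]] .
  have line: "c ` m \<in> pg_lines" if "m \<in> pg_lines" for m
    unfolding c by (rule projectivity_pg_subspaces[OF M that])
  have sp: "c ` pg_span (m1 \<union> m2) = pg_span (c ` m1 \<union> c ` m2)"
    if "m1 \<in> pg_lines" "m2 \<in> pg_lines" for m1 m2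
    unfolding c image_Un[symmetric]
    by (rule projectivity_pg_span[OF M Un_least[OF pts[OF that(1)] pts[OF that(2)]]])
  show ?thesis
  proof (intro equalityI subsetI)
    fix \<tau> assume "\<tau> \<in> (`) c ` two_line_planes g \<pi> l P"
    then obtain m1 m2 where m: "m1 \<in> pg_lines" "m1 \<subseteq> \<pi>" "P \<in> m1" "m1 \<noteq> l"
        "m2 \<in> pg_lines" "m2 \<subseteq> g" "P \<in> m2" "m2 \<noteq> l" "\<tau> = c ` pg_span (m1 \<union> m2)"
      unfolding two_line_planes_def by blast
    have "pg_span (c ` m1 \<union> c ` m2) \<in> two_line_planes (c ` g) (c ` \<pi>) (c ` l) (c P)"
      by (intro two_line_planesI line)
        (simp_all only: m(1-8) eq mem sub[OF _ g] sub[OF _ \<pi>] not_False_eq_True)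
    moreover have "pg_span (c ` m1 \<union> c ` m2) = \<tau>"
      by (rule trans[OF sp[OF m(1,5), symmetric] m(9)[symmetric]])
    ultimately show "\<tau> \<in> two_line_planes (c ` g) (c ` \<pi>) (c ` l) (c P)"
      by (rule back_subst)
  next
    fix \<tau> assume "\<tau> \<in> two_line_planes (c ` g) (c ` \<pi>) (c ` l) (c P)"
    then obtain n1 n2 where n: "n1 \<in> pg_lines" "n1 \<subseteq> c ` \<pi>" "c P \<in> n1" "n1 \<noteq> c ` l"
        "n2 \<in> pg_lines" "n2 \<subseteq> c ` g" "c P \<in> n2" "n2 \<noteq> c ` l" "\<tau> = pg_span (n1 \<union> n2)"
      by (rule two_line_planes_cases)
    \<comment> \<open>Every line is the image of a line, so the moved configuration can be pulled
      back.\<close>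
    have "n1 \<in> (`) c ` pg_lines" "n2 \<in> (`) c ` pg_lines"
      unfolding c projectivity_pg_subspaces_eq[OF M] by (fact n)+
    then obtain m1 m2 where m: "m1 \<in> pg_lines" "n1 = c ` m1" "m2 \<in> pg_lines" "n2 = c ` m2"
      by blast
    then have "pg_span (m1 \<union> m2) \<in> two_line_planes g \<pi> l P"
      using n(1-8) by (intro two_line_planesI)
        (simp_all only: eq mem sub[OF _ g] sub[OF _ \<pi>] not_False_eq_True)
    moreover have "\<tau> = c ` pg_span (m1 \<union> m2)" using n(9) m by (simp only: sp)
    ultimately show "\<tau> \<in> (`) c ` two_line_planes g \<pi> l P" by blast
  qed
qed

lemma two_line_planesE:
  fixes g \<pi> l :: "('a::field^6) set set"
  assumes g: "g \<in> pg_planes" "g \<subseteq> klein_quadric"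
    and \<pi>: "\<pi> \<in> pg_planes" "\<pi> \<subseteq> klein_quadric"
    and l: "l = g \<inter> \<pi>" "l \<in> pg_lines"
    and \<tau>: "\<tau> \<in> two_line_planes g \<pi> l P"
  obtains m1 m2 where "m1 \<in> pg_lines" "m2 \<in> pg_lines" "m1 \<subseteq> \<pi>" "m2 \<subseteq> g" "m1 \<inter> m2 = {P}"
    "\<tau> = pg_span (m1 \<union> m2)" "\<tau> \<in> pg_planes"
    "\<tau> \<inter> klein_quadric = m1 \<union> m2" "\<tau> \<inter> g = m2"
    "\<And>R. R \<in> g \<Longrightarrow> \<tau> \<subseteq> points_of (klein_perp R) \<longleftrightarrow> R \<in> l"
proof -
  obtain m1 m2 where m: "m1 \<in> pg_lines" "m1 \<subseteq> \<pi>" "P \<in> m1" "m1 \<noteq> l"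
      "m2 \<in> pg_lines" "m2 \<subseteq> g" "P \<in> m2" "m2 \<noteq> l" "\<tau> = pg_span (m1 \<union> m2)"
    using \<tau> unfolding two_line_planes_def by blast
  note span = pg_span_two_lines[OF g \<pi> l m(1,3,2,4) m(5,7,6,8)]
  show ?thesis
    by (rule that[of m1 m2]) (use m span in simp_all)
qed

text \<open>Each of the two pencils offers \<open>q\<close> lines besides \<open>l\<close>, and a
  plane \<open>\<tau>\<close> determines its pair: \<open>m2\<close> is
  \<open>\<tau> \<inter> g\<close>, and \<open>m1\<close> is the other line of the section with the
  quadric.\<close>

lemma card_two_line_planes:
  fixes g \<pi> l :: "('a::{field,finite}^6) set set"
  assumes g: "g \<in> pg_planes" "g \<subseteq> klein_quadric"
    and \<pi>: "\<pi> \<in> pg_planes" "\<pi> \<subseteq> klein_quadric"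
    and l: "l = g \<inter> \<pi>" "l \<in> pg_lines" and P: "P \<in> l"
  shows "card (two_line_planes g \<pi> l P) = CARD('a)\<^sup>2"
proof -
  define N where "N A = {m \<in> pg_lines. m \<subseteq> A \<and> P \<in> m} - {l}" for A
  have card_N: "card (N A) = CARD('a)" if "A \<in> pg_planes" "l \<subseteq> A" for A
    using that card_pg_lines_through_point[of A P] P l unfolding N_def
    by (subst card_Diff_singleton) auto
  have "two_line_planes g \<pi> l P = (\<lambda>(m1, m2). pg_span (m1 \<union> m2)) ` (N \<pi> \<times> N g)"
  proof (intro equalityI subsetI)
    fix \<tau> assume "\<tau> \<in> two_line_planes g \<pi> l P"
    then obtain m1 m2 where m: "m1 \<in> pg_lines" "m1 \<subseteq> \<pi>" "P \<in> m1" "m1 \<noteq> l"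
        "m2 \<in> pg_lines" "m2 \<subseteq> g" "P \<in> m2" "m2 \<noteq> l" "\<tau> = pg_span (m1 \<union> m2)"
      unfolding two_line_planes_def by blast
    then have "(m1, m2) \<in> N \<pi> \<times> N g" by (simp add: N_def)
    then show "\<tau> \<in> (\<lambda>(m1, m2). pg_span (m1 \<union> m2)) ` (N \<pi> \<times> N g)"
      using m(9) by (intro image_eqI[of _ _ "(m1, m2)"]) simp_all
  qed (auto simp: N_def simp del: One_nat_def intro!: two_line_planesI)
  moreover have "inj_on (\<lambda>(m1, m2). pg_span (m1 \<union> m2)) (N \<pi> \<times> N g)"
  proof -
    have "m1 = m1' \<and> m2 = m2'"
      if m: "m1 \<in> N \<pi>" "m2 \<in> N g" "m1' \<in> N \<pi>" "m2' \<in> N g"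
        and eq: "pg_span (m1 \<union> m2) = pg_span (m1' \<union> m2')" for m1 m2 m1' m2'
    proof -
      have lines: "m1 \<in> pg_lines" "m2 \<in> pg_lines" "m1' \<in> pg_lines" "m2' \<in> pg_lines"
        using m by (auto simp: N_def)
      have s: "pg_span (m1 \<union> m2) \<inter> klein_quadric = m1 \<union> m2" "pg_span (m1 \<union> m2) \<inter> g = m2"
        using m by (intro pg_span_two_lines[OF g \<pi> l, of m1 P m2]; simp add: N_def)+
      have s': "pg_span (m1' \<union> m2') \<inter> klein_quadric = m1' \<union> m2'"
        "pg_span (m1' \<union> m2') \<inter> g = m2'" "m1' \<inter> m2' = {P}"
        using m by (intro pg_span_two_lines[OF g \<pi> l, of m1' P m2']; simp add: N_def)+
      have "m2 = m2'" using s s' eq by metis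
      \<comment> \<open>Equal lines would meet in a line, not in the single point
        \<open>P\<close>.\<close>
      moreover have "m1' \<noteq> m2'"
        using s'(3) lines singleton_not_pg_line by (metis Int_absorb)
      ultimately show ?thesis
        using s s' eq pg_line_unique_in_pair[of m1 m1' m2] lines by metis
    qed
    then show ?thesis unfolding inj_on_def by fast
  qed
  ultimately show ?thesis
    using g \<pi> l by (simp add: card_image card_cartesian_product card_N power2_eq_square)
qed

text \<open>The section of \<open>\<tau>\<close> is a pair of lines, one of them
  \<open>\<tau> \<inter> g\<close>; hence both constructions use the same pair, whose only common
  point is \<open>P\<close> as well as \<open>P'\<close>.\<close>

lemma two_line_planes_determine_point:
  fixes g :: "('a::field^6) set set"
  assumes g: "g \<in> pg_planes" "g \<subseteq> klein_quadric"
    and \<pi>: "\<pi> \<in> pg_planes" "\<pi> \<subseteq> klein_quadric" "l = g \<inter> \<pi>" "l \<in> pg_lines"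
    and \<pi>': "\<pi>' \<in> pg_planes" "\<pi>' \<subseteq> klein_quadric" "l' = g \<inter> \<pi>'" "l' \<in> pg_lines"
    and \<tau>: "\<tau> \<in> two_line_planes g \<pi> l P" "\<tau> \<in> two_line_planes g \<pi>' l' P'"
  shows "P = P'"
proof -
  obtain m1 m2 where m: "m1 \<in> pg_lines" "m2 \<in> pg_lines" "m1 \<inter> m2 = {P}"
      "\<tau> \<inter> klein_quadric = m1 \<union> m2" "\<tau> \<inter> g = m2"
    by (rule two_line_planesE[OF g \<pi> \<tau>(1)])
  obtain n1 n2 where n: "n1 \<in> pg_lines" "n2 \<in> pg_lines" "n1 \<inter> n2 = {P'}"
      "\<tau> \<inter> klein_quadric = n1 \<union> n2" "\<tau> \<inter> g = n2"
    by (rule two_line_planesE[OF g \<pi>' \<tau>(2)])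
  have "n1 \<noteq> m2"
    using n m singleton_not_pg_line by (metis Int_absorb)
  then have "m1 = n1" using m n pg_line_unique_in_pair[of m1 n1 m2] by simp
  then show ?thesis using m n by simp
qed

text \<open>By \<open>subspace_subset_Un\<close> the plane would lie in one of the lines, against
  the dimensions. With equal lines it also shows that no plane is a line.\<close>

lemma pg_plane_not_Un_lines:
  fixes \<tau> :: "('a::field^'n) set set"
  assumes "\<tau> \<in> pg_planes" "m1 \<in> pg_lines" "m2 \<in> pg_lines"
  shows "\<tau> \<noteq> m1 \<union> m2"
proof
  assume eq: "\<tau> = m1 \<union> m2"
  obtain W where W: "vec.subspace W" "vec.dim W = 3" "\<tau> = points_of W"
    by (rule pg_subspacesE[OF assms(1)]) simp
  obtain A where A: "vec.subspace A" "vec.dim A = 2" "m1 = points_of A"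
    by (rule pg_subspacesE[OF assms(2)]) simp
  obtain B where B: "vec.subspace B" "vec.dim B = 2" "m2 = points_of B"
    by (rule pg_subspacesE[OF assms(3)]) simp
  have "W = A \<union> B"
    using eq unfolding W(3) A(3) B(3) points_of_Un[OF A(1) B(1), symmetric]
    by (simp add: points_of_eq_iff scaling_closed_intros W A B)
  then have "W \<subseteq> A \<or> W \<subseteq> B" using subspace_subset_Un[OF A(1) B(1) W(1)] by blast
  then show False
    using vec.dim_subset[of W A] vec.dim_subset[of W B] W A B by auto
qed

subsection \<open>The orbit under the Singer group\<close>

text \<open>Unique existence is the form in which the Singer group enters the counts: existence
  carries points and lines of \<open>g\<close> to one another, uniqueness separates the
  images.\<close>

locale klein_singer =
  fixes Latin Greek :: "('a::{field,finite}^6) set set set"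
    and g \<pi> l :: "('a^6) set set"
    and C :: "(('a^6) set \<Rightarrow> ('a^6) set) set"
  assumes families: "klein_families Latin Greek"
    and g_Greek: "g \<in> Greek" and \<pi>_Latin: "\<pi> \<in> Latin"
    and l_line: "l \<in> pg_lines" and l_g: "l \<subseteq> g" and l_\<pi>: "l \<subseteq> \<pi>"
    and C_projectivity: "c \<in> C \<Longrightarrow> \<exists>M. invertible M \<and> c = projectivity M"
    and C_quadric: "c \<in> C \<Longrightarrow> c ` klein_quadric = klein_quadric"
    and C_g: "c \<in> C \<Longrightarrow> c ` g = g"
    and C_points: "p \<in> g \<Longrightarrow> p' \<in> g \<Longrightarrow> \<exists>!c. c \<in> C \<and> c p = p'"
    and C_lines: "m \<in> pg_lines \<Longrightarrow> m' \<in> pg_lines \<Longrightarrow> m \<subseteq> g \<Longrightarrow> m' \<subseteq> g \<Longrightarrow>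
      \<exists>!c. c \<in> C \<and> c ` m = m'"
begin

lemma singular_planes: "Latin \<union> Greek = {\<alpha> \<in> pg_planes. \<alpha> \<subseteq> klein_quadric}"
  and families_Int: "Latin \<inter> Greek = {}"
  and card_Greek: "card Greek = CARD('a) ^ 3 + CARD('a)\<^sup>2 + CARD('a) + 1"
  and Latin_meet: "\<forall>\<alpha>\<in>Latin. \<forall>\<beta>\<in>Latin. \<alpha> \<noteq> \<beta> \<longrightarrow> (\<exists>p. \<alpha> \<inter> \<beta> = {p})"
  and Greek_meet: "\<forall>\<alpha>\<in>Greek. \<forall>\<beta>\<in>Greek. \<alpha> \<noteq> \<beta> \<longrightarrow> (\<exists>p. \<alpha> \<inter> \<beta> = {p})"
  and mixed_meet: "\<forall>\<alpha>\<in>Latin. \<forall>\<beta>\<in>Greek. \<alpha> \<inter> \<beta> = {} \<or> \<alpha> \<inter> \<beta> \<in> pg_lines"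
  using families unfolding klein_families_def ball_simps by simp_all

lemma singular_plane_cases:
  assumes "\<alpha> \<in> pg_planes" "\<alpha> \<subseteq> klein_quadric"
  shows "\<alpha> \<in> Latin \<or> \<alpha> \<in> Greek"
  unfolding Un_iff[symmetric] singular_planes using assms by simp

lemma family_plane: "\<alpha> \<in> Latin \<or> \<alpha> \<in> Greek \<Longrightarrow> \<alpha> \<in> pg_planes \<and> \<alpha> \<subseteq> klein_quadric"
  unfolding Un_iff[symmetric] singular_planes by simp

lemmas g_plane = family_plane[OF disjI2[OF g_Greek], THEN conjunct1]
  and g_quadric = family_plane[OF disjI2[OF g_Greek], THEN conjunct2]

lemma families_disjoint: "\<alpha> \<in> Latin \<Longrightarrow> \<alpha> \<notin> Greek"
  using families_Int by blast

lemma same_family_meet: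
  "\<alpha> \<in> Latin \<and> \<beta> \<in> Latin \<or> \<alpha> \<in> Greek \<and> \<beta> \<in> Greek \<Longrightarrow> \<alpha> \<noteq> \<beta> \<Longrightarrow> \<exists>p. \<alpha> \<inter> \<beta> = {p}"
  using Latin_meet Greek_meet by metis

lemma other_family_meet:
  "\<alpha> \<in> Latin \<Longrightarrow> \<beta> \<in> Greek \<Longrightarrow> \<alpha> \<inter> \<beta> = {} \<or> \<alpha> \<inter> \<beta> \<in> pg_lines"
  using mixed_meet by metis

text \<open>Distinct planes of one family share a single point, which cannot hold a line.\<close>

lemma same_family_eq_if_common_line:
  assumes "\<alpha> \<in> Latin \<and> \<beta> \<in> Latin \<or> \<alpha> \<in> Greek \<and> \<beta> \<in> Greek"
    and "m \<in> pg_lines" "m \<subseteq> \<alpha>" "m \<subseteq> \<beta>"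
  shows "\<alpha> = \<beta>"
proof (rule ccontr)
  assume "\<alpha> \<noteq> \<beta>"
  then obtain p where p: "\<alpha> \<inter> \<beta> = {p}" using same_family_meet[OF assms(1)] by auto
  have "m \<subseteq> \<alpha> \<inter> \<beta>" using assms(3,4) by (rule Int_greatest)
  then show False using pg_line_not_subset_singleton[OF assms(2), of p] unfolding p by contradiction
qed

lemma g_points: "p \<in> g \<Longrightarrow> p \<in> pg_points"
  by (rule subsetD[OF pg_subspaces_subset_points[OF g_plane]])

lemma C_inj: "c \<in> C \<Longrightarrow> inj_on c pg_points"
  using C_projectivity[of c] by (auto intro: inj_on_projectivity)

lemma C_pg_subspaces: "c \<in> C \<Longrightarrow> \<tau> \<in> pg_subspaces k \<Longrightarrow> c ` \<tau> \<in> pg_subspaces k"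
  using C_projectivity[of c] by (auto intro: projectivity_pg_subspaces)

lemma C_singular_plane:
  assumes c: "c \<in> C" and \<alpha>: "\<alpha> \<in> pg_planes" "\<alpha> \<subseteq> klein_quadric"
  shows "c ` \<alpha> \<in> pg_planes" "c ` \<alpha> \<subseteq> klein_quadric"
  using C_pg_subspaces[OF c \<alpha>(1)] image_mono[OF \<alpha>(2), of c] C_quadric[OF c] by simp_all

lemma C_Int_g:
  assumes "c \<in> C" "\<alpha> \<subseteq> pg_points"
  shows "c ` \<alpha> \<inter> g = c ` (\<alpha> \<inter> g)"
  using inj_on_image_Int[OF C_inj[OF assms(1)] assms(2) pg_subspaces_subset_points[OF g_plane]]
    C_g[OF assms(1)] by simp

text \<open>A Greek plane other than \<open>g\<close> meets \<open>g\<close> in one point, and so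
  does its image; a Latin plane would meet \<open>g\<close> in nothing or in a line.\<close>

lemma C_Greek:
  assumes c: "c \<in> C" and h: "h \<in> Greek"
  shows "c ` h \<in> Greek"
proof (cases "h = g")
  case True
  then show ?thesis using C_g[OF c] g_Greek by simp
next
  case False
  have h': "h \<in> pg_planes" "h \<subseteq> klein_quadric" using family_plane[of h] h by simp_all
  obtain p where "h \<inter> g = {p}" using same_family_meet[of h g] h g_Greek False by auto
  then have "c ` h \<inter> g = {c p}"
    using C_Int_g[OF c pg_subspaces_subset_points[OF h'(1)]] by simp
  then have "c ` h \<notin> Latin"
    using other_family_meet[of "c ` h" g] g_Greek singleton_not_pg_line[of "c p"]
    by (metis insert_not_empty)
  then show ?thesis using singular_plane_cases[OF C_singular_plane[OF c h']] by simp
qed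

text \<open>Otherwise the image of \<open>\<pi>\<close> and the plane \<open>g\<close> would be
  Greek planes sharing the image of \<open>l\<close>, hence equal; as \<open>c\<close> fixes
  \<open>g\<close>, injectivity would give \<open>\<pi> = g\<close>.\<close>

lemma C_Latin:
  assumes c: "c \<in> C"
  shows "c ` \<pi> \<in> Latin"
proof (rule ccontr)
  assume not: "c ` \<pi> \<notin> Latin"
  have p: "\<pi> \<in> pg_planes" "\<pi> \<subseteq> klein_quadric"
    using family_plane[of \<pi>] \<pi>_Latin by simp_all
  have "c ` \<pi> \<in> Greek" using not singular_plane_cases[OF C_singular_plane[OF c p]] by simp
  moreover have "c ` l \<subseteq> g" using image_mono[OF l_g, of c] C_g[OF c] by simp
  ultimately have "c ` \<pi> = g"
    using g_Greek
    by (intro same_family_eq_if_common_line[of _ _ "c ` l"] C_pg_subspaces[OF c l_line]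
        image_mono[OF l_\<pi>]) simp_all
  also have "\<dots> = c ` g" using C_g[OF c] by simp
  finally have "\<pi> = g"
    using inj_on_image_eq_iff[OF C_inj[OF c] pg_subspaces_subset_points[OF p(1)]
        pg_subspaces_subset_points[OF g_plane]] by simp
  then show False using families_disjoint[OF \<pi>_Latin] g_Greek by simp
qed

lemma C_l:
  assumes c: "c \<in> C"
  shows "c ` l \<in> pg_lines" "c ` l \<subseteq> g" "c ` l \<subseteq> c ` \<pi>" "c ` l = g \<inter> c ` \<pi>"
proof -
  show line: "c ` l \<in> pg_lines" by (rule C_pg_subspaces[OF c l_line])
  show sub: "c ` l \<subseteq> g" "c ` l \<subseteq> c ` \<pi>"
    using image_mono[OF l_g, of c] image_mono[OF l_\<pi>, of c] C_g[OF c] by simp_all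
  have sub': "c ` l \<subseteq> c ` \<pi> \<inter> g" using sub(2,1) by (rule Int_greatest)
  have "c ` l \<noteq> {}" using pg_line_not_subset_singleton[OF line] by auto
  then have "c ` \<pi> \<inter> g \<noteq> {}" using sub' subset_empty by metis
  \<comment> \<open>A nonempty intersection of planes of different families is a line, and here it
    contains the image of \<open>l\<close>.\<close>
  then have "c ` \<pi> \<inter> g \<in> pg_lines"
    using other_family_meet[OF C_Latin[OF c] g_Greek] by simp
  then show "c ` l = g \<inter> c ` \<pi>"
    using pg_subspaces_eq_if_subset[OF line _ sub'] by (simp add: Int_commute)
qed

lemma C_\<pi>_plane:
  assumes "c \<in> C"
  shows "c ` \<pi> \<in> pg_planes" "c ` \<pi> \<subseteq> klein_quadric"
  using family_plane[of "c ` \<pi>"] C_Latin[OF assms] by simp_all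

lemma card_g: "card g = CARD('a)\<^sup>2 + CARD('a) + 1"
proof -
  obtain U where "vec.subspace U" "vec.dim U = 3" "g = points_of U"
    by (rule pg_subspacesE[OF g_plane]) simp
  then show ?thesis using card_points_of_plane[of U] by simp
qed

lemma card_Greek_through_point:
  assumes R: "R \<in> g"
  shows "card {h \<in> Greek - {g}. R \<in> h} = CARD('a)"
proof -
  let ?F = "\<lambda>p. {h \<in> Greek - {g}. p \<in> h}"
  \<comment> \<open>An element taking \<open>p\<close> to \<open>p'\<close> embeds the Greek planes
    through \<open>p\<close> into those through \<open>p'\<close>; exchanging the points gives
    equality.\<close>
  have le: "card (?F p) \<le> card (?F p')" if pp: "p \<in> g" "p' \<in> g" for p p'
  proof -
    obtain c where c: "c \<in> C" "c p = p'" using C_points[OF pp] by auto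
    have sub: "h \<subseteq> pg_points" if "h \<in> Greek" for h
      using family_plane[of h] pg_subspaces_subset_points[of h 2] that by simp
    have "inj_on ((`) c) (?F p)"
      using inj_on_image_eq_iff[OF C_inj[OF c(1)] sub sub] by (auto simp: inj_on_def)
    moreover have "(`) c ` ?F p \<subseteq> ?F p'"
    proof (intro image_subsetI)
      fix h assume h: "h \<in> ?F p"
      then have "c ` h \<noteq> c ` g"
        using inj_on_image_eq_iff[OF C_inj[OF c(1)] sub sub, of h g] g_Greek by auto
      then show "c ` h \<in> ?F p'" using h c C_Greek[OF c(1), of h] C_g[OF c(1)] by auto
    qed
    ultimately show ?thesis by (intro card_inj_on_le) auto
  qed
  have eq: "card (?F p) = card (?F R)" if "p \<in> g" for p
    using le[OF that R] le[OF R that] by simp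
  have one: "\<exists>p. h \<inter> g = {p}" if "h \<in> Greek - {g}" for h
    using that same_family_meet[of h g] g_Greek by simp
  have "Greek - {g} = (\<Union>p\<in>g. ?F p)"
  proof (intro equalityI subsetI)
    fix h assume h: "h \<in> Greek - {g}"
    obtain p where "h \<inter> g = {p}" using one[OF h] by (rule exE)
    then have "p \<in> h" "p \<in> g" by auto
    then show "h \<in> (\<Union>p\<in>g. ?F p)" using h by auto
  qed auto
  also have "card \<dots> = (\<Sum>p\<in>g. card (?F p))"
  proof (rule card_UN_disjoint)
    show "\<forall>i\<in>g. \<forall>j\<in>g. i \<noteq> j \<longrightarrow> ?F i \<inter> ?F j = {}"
    proof (intro ballI impI equals0I)
      fix i j h assume ij: "i \<in> g" "j \<in> g" "i \<noteq> j" and h: "h \<in> ?F i \<inter> ?F j"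
      obtain p where "h \<inter> g = {p}" using one[of h] h by auto
      moreover have "i \<in> h \<inter> g" "j \<in> h \<inter> g" using ij h by auto
      ultimately show False using ij(3) by simp
    qed
  qed auto
  also have "\<dots> = card g * card (?F R)" using eq by simp
  also have "card (Greek - {g}) = CARD('a) ^ 3 + CARD('a)\<^sup>2 + CARD('a)"
    using card_Greek g_Greek by simp
  \<comment> \<open>The total \<open>q^3 + q^2 + q\<close> factors as
    \<open>(q^2 + q + 1) * q\<close>, and its first factor is \<open>card g\<close>.\<close>
  finally have "card g * CARD('a) = card g * card (?F R)"
    by (simp add: card_g power3_eq_cube power2_eq_square algebra_simps)
  moreover have "card g \<noteq> 0" by (simp add: card_g)
  ultimately show ?thesis by (simp only: mult_cancel1) simp
qed

text \<open>Line transitivity makes \<open>m\<close> an image of \<open>l\<close>, so besides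
  \<open>g\<close> the image of \<open>\<pi>\<close> is a singular plane through \<open>m\<close>;
  neither family has a second one.\<close>

lemma card_tangent_planes:
  assumes m: "m \<in> pg_lines" "m \<subseteq> g"
  shows "card {\<tau> \<in> pg_planes. \<tau> \<inter> klein_quadric = m} = CARD('a) - 1"
proof -
  obtain c where c: "c \<in> C" "c ` l = m" using C_lines[OF l_line m(1) l_g m(2)] by auto
  have m\<pi>: "m \<subseteq> c ` \<pi>" using C_l(3)[OF c(1)] c(2) by simp
  show ?thesis
  proof (rule card_tangent_planes_through_pg_line[OF g_plane g_quadric m(2) C_\<pi>_plane[OF c(1)] m\<pi> m(1)])
    show "g \<noteq> c ` \<pi>" using families_disjoint[OF C_Latin[OF c(1)]] g_Greek by auto
    show "\<tau> = g \<or> \<tau> = c ` \<pi>" if "\<tau> \<in> pg_planes" "\<tau> \<subseteq> klein_quadric" "m \<subseteq> \<tau>" for \<tau>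
      using singular_plane_cases[OF that(1,2)]
        same_family_eq_if_common_line[OF _ m(1) that(3) m(2)] g_Greek
        same_family_eq_if_common_line[OF _ m(1) that(3) m\<pi>] C_Latin[OF c(1)] by auto
  qed
qed

lemma card_tangent_planes_in_hyperplane:
  assumes R: "R \<in> g"
  shows "card {\<tau> \<in> pg_planes. (\<exists>m\<in>pg_lines. m \<subseteq> g \<and> \<tau> \<inter> klein_quadric = m) \<and>
      \<tau> \<subseteq> points_of (klein_perp R)} = (CARD('a) + 1) * (CARD('a) - 1)" (is "card ?Z = _")
proof -
  let ?M = "{m \<in> pg_lines. m \<subseteq> g \<and> R \<in> m}"
  \<comment> \<open>Each plane is filed under its section \<open>m\<close>; containment in the
    tangent hyperplane becomes \<open>R \<in> m\<close>.\<close>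
  have "?Z = (\<Union>m\<in>?M. {\<tau> \<in> pg_planes. \<tau> \<inter> klein_quadric = m})"
    using tangent_plane_subset_points_of_klein_perp_iff[OF g_plane g_quadric _ _ _ _ R] by auto
  also have "card \<dots> = (\<Sum>m\<in>?M. card {\<tau> \<in> pg_planes. \<tau> \<inter> klein_quadric = m})"
    by (rule card_UN_disjoint) auto
  also have "\<dots> = (\<Sum>m\<in>?M. CARD('a) - 1)"
    by (intro sum.cong refl card_tangent_planes) auto
  also have "\<dots> = (CARD('a) + 1) * (CARD('a) - 1)"
    using card_pg_lines_through_point[OF g_plane R] by simp
  finally show ?thesis .
qed

lemma C_two_line_planes:
  assumes c: "c \<in> C" and P: "P \<in> l"
  shows "(`) c ` two_line_planes g \<pi> l P = two_line_planes g (c ` \<pi>) (c ` l) (c P)"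
proof -
  obtain M where M: "invertible M" "c = projectivity M" using C_projectivity[OF c] by auto
  have "\<pi> \<in> pg_planes" using family_plane[of \<pi>] \<pi>_Latin by simp
  then show ?thesis
    using two_line_planes_image[OF M pg_subspaces_subset_points[OF g_plane]
        pg_subspaces_subset_points pg_subspaces_subset_points[OF l_line], of \<pi> 2 P]
      g_points[OF subsetD[OF l_g P]] C_g[OF c] by simp
qed

text \<open>By sharp transitivity on lines, sending \<open>c\<close> to the image of
  \<open>l\<close> is a bijection onto the lines of \<open>g\<close> through
  \<open>R\<close>.\<close>

lemma card_C_lines_through_point:
  assumes R: "R \<in> g"
  shows "card {c \<in> C. R \<in> c ` l} = CARD('a) + 1"
proof -
  have inj: "inj_on (\<lambda>c. c ` l) {c \<in> C. R \<in> c ` l}"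
  proof (rule inj_onI)
    fix c c' assume "c \<in> {c \<in> C. R \<in> c ` l}" "c' \<in> {c \<in> C. R \<in> c ` l}" "c ` l = c' ` l"
    then have c: "c \<in> C" "c' \<in> C" "c' ` l = c ` l" by simp_all
    show "c = c'"
      using C_lines[OF l_line C_l(1)[OF c(1)] l_g C_l(2)[OF c(1)]] c by (metis (no_types))
  qed
  have img: "(\<lambda>c. c ` l) ` {c \<in> C. R \<in> c ` l} = {m \<in> pg_lines. m \<subseteq> g \<and> R \<in> m}"
  proof (intro equalityI subsetI)
    fix m assume m: "m \<in> {m \<in> pg_lines. m \<subseteq> g \<and> R \<in> m}"
    then obtain c where "c \<in> C" "c ` l = m" using C_lines[OF l_line _ l_g, of m] by auto
    then show "m \<in> (\<lambda>c. c ` l) ` {c \<in> C. R \<in> c ` l}" using m by auto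
  next
    fix m assume "m \<in> (\<lambda>c. c ` l) ` {c \<in> C. R \<in> c ` l}"
    then obtain c where "c \<in> C" "R \<in> c ` l" "m = c ` l" by auto
    then show "m \<in> {m \<in> pg_lines. m \<subseteq> g \<and> R \<in> m}" using C_l(1,2)[of c] by simp
  qed
  show ?thesis
    using card_image[OF inj] card_pg_lines_through_point[OF g_plane R] unfolding img by simp
qed

lemma card_two_line_planes_in_hyperplane:
  assumes P: "P \<in> l" and R: "R \<in> g"
  shows "card {\<tau> \<in> (\<Union>c\<in>C. (`) c ` two_line_planes g \<pi> l P). \<tau> \<subseteq> points_of (klein_perp R)}
    = (CARD('a) + 1) * CARD('a)\<^sup>2" (is "card ?T = _")
proof -
  let ?S = "\<lambda>c. two_line_planes g (c ` \<pi>) (c ` l) (c P)"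
  \<comment> \<open>The criterion depends on \<open>c\<close> alone, so each class
    \<open>?S c\<close> lies in the hyperplane entirely or contributes nothing.\<close>
  have sub: "\<tau> \<subseteq> points_of (klein_perp R) \<longleftrightarrow> R \<in> c ` l" if "c \<in> C" "\<tau> \<in> ?S c" for c \<tau>
    by (rule two_line_planesE[OF g_plane g_quadric C_\<pi>_plane[OF that(1)] C_l(4,1)[OF that(1)] that(2)])
      (use R in simp)
  have "(\<Union>c\<in>C. (`) c ` two_line_planes g \<pi> l P) = (\<Union>c\<in>C. ?S c)"
    using C_two_line_planes[OF _ P] by simp
  moreover have "{\<tau> \<in> (\<Union>c\<in>C. ?S c). \<tau> \<subseteq> points_of (klein_perp R)}
      = (\<Union>c\<in>{c \<in> C. R \<in> c ` l}. ?S c)"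
  proof (intro equalityI subsetI)
    fix \<tau> assume "\<tau> \<in> {\<tau> \<in> (\<Union>c\<in>C. ?S c). \<tau> \<subseteq> points_of (klein_perp R)}"
    then obtain c where c: "c \<in> C" "\<tau> \<in> ?S c" "\<tau> \<subseteq> points_of (klein_perp R)"
      by (elim CollectE conjE UN_E)
    then have "c \<in> {c \<in> C. R \<in> c ` l}" using sub[OF c(1,2)] by simp
    then show "\<tau> \<in> (\<Union>c\<in>{c \<in> C. R \<in> c ` l}. ?S c)" using c(2) by (rule UN_I[of c _ \<tau> ?S])
  next
    fix \<tau> assume "\<tau> \<in> (\<Union>c\<in>{c \<in> C. R \<in> c ` l}. ?S c)"
    then obtain c where c: "c \<in> C" "R \<in> c ` l" "\<tau> \<in> ?S c"
      by (elim UN_E CollectE conjE)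
    have "\<tau> \<in> (\<Union>c\<in>C. ?S c)" by (rule UN_I[of c C \<tau> ?S, OF c(1,3)])
    moreover have "\<tau> \<subseteq> points_of (klein_perp R)" unfolding sub[OF c(1,3)] by (rule c(2))
    ultimately show "\<tau> \<in> {\<tau> \<in> (\<Union>c\<in>C. ?S c). \<tau> \<subseteq> points_of (klein_perp R)}"
      by (intro CollectI conjI)
  qed
  ultimately have "?T = (\<Union>c\<in>{c \<in> C. R \<in> c ` l}. ?S c)" by (simp only:)
  also have "card \<dots> = (\<Sum>c\<in>{c \<in> C. R \<in> c ` l}. card (?S c))"
  proof (rule card_UN_disjoint)
    show "\<forall>c\<in>{c \<in> C. R \<in> c ` l}. \<forall>d\<in>{c \<in> C. R \<in> c ` l}. c \<noteq> d \<longrightarrow> ?S c \<inter> ?S d = {}"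
    proof (intro ballI impI)
      fix c d assume cd: "c \<in> {c \<in> C. R \<in> c ` l}" "d \<in> {c \<in> C. R \<in> c ` l}" "c \<noteq> d"
      have C: "c \<in> C" "d \<in> C" using cd by auto
      have "P \<in> g" using l_g P by (rule subsetD)
      moreover from this have "c P \<in> g" using imageI[of P g c] C_g[OF C(1)] by simp
      ultimately have "\<exists>!k. k \<in> C \<and> k P = c P" by (rule C_points)
      \<comment> \<open>Distinct group elements move \<open>P\<close> to distinct points, whereas a
        plane common to both classes would force the same point.\<close>
      then have "c P \<noteq> d P" using C cd(3) by (metis (no_types))
      then show "?S c \<inter> ?S d = {}"
        using two_line_planes_determine_point[OF g_plane g_quadric
            C_\<pi>_plane[OF C(1)] C_l(4,1)[OF C(1)] C_\<pi>_plane[OF C(2)] C_l(4,1)[OF C(2)]]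
        by auto
    qed
  qed auto
  also have "\<dots> = (\<Sum>c\<in>{c \<in> C. R \<in> c ` l}. CARD('a)\<^sup>2)"
  proof (intro sum.cong refl)
    fix c assume "c \<in> {c \<in> C. R \<in> c ` l}"
    then have c: "c \<in> C" by simp
    show "card (?S c) = CARD('a)\<^sup>2"
      by (rule card_two_line_planes[OF g_plane g_quadric C_\<pi>_plane[OF c] C_l(4,1)[OF c] imageI[OF P]])
  qed
  also have "\<dots> = (CARD('a) + 1) * CARD('a)\<^sup>2"
    using card_C_lines_through_point[OF R] by simp
  finally show ?thesis .
qed

text \<open>The section is a union of two distinct lines, hence neither a line nor the whole plane.
  This keeps the orbit apart from \<open>\<Z>\<close> and from \<open>\<Y>\<close>.\<close>

lemma orbit_two_line_planes_sections:
  assumes P: "P \<in> l" and \<tau>: "\<tau> \<in> (\<Union>c\<in>C. (`) c ` two_line_planes g \<pi> l P)"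
  shows "\<not> \<tau> \<subseteq> klein_quadric" "\<tau> \<inter> klein_quadric \<notin> pg_lines"
proof -
  obtain c where c: "c \<in> C" "\<tau> \<in> two_line_planes g (c ` \<pi>) (c ` l) (c P)"
    using \<tau> C_two_line_planes[OF _ P] by auto
  obtain m1 m2 where m: "m1 \<in> pg_lines" "m2 \<in> pg_lines" "m1 \<subseteq> c ` \<pi>" "m2 \<subseteq> g" "m1 \<inter> m2 = {c P}"
    "\<tau> \<in> pg_planes" "\<tau> \<inter> klein_quadric = m1 \<union> m2" "\<tau> \<inter> g = m2"
    by (rule two_line_planesE[OF g_plane g_quadric C_\<pi>_plane[OF c(1)] C_l(4,1)[OF c(1)] c(2)])
  have ne: "m1 \<noteq> m2" using m(1,5) singleton_not_pg_line by (metis Int_absorb)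
  show not_line: "\<tau> \<inter> klein_quadric \<notin> pg_lines"
  proof
    assume "\<tau> \<inter> klein_quadric \<in> pg_lines"
    then have line: "m1 \<union> m2 \<in> pg_lines" unfolding m(7) .
    show False
      using ne pg_subspaces_eq_if_subset[OF m(1) line Un_upper1]
        pg_subspaces_eq_if_subset[OF m(2) line Un_upper2] by simp
  qed
  show "\<not> \<tau> \<subseteq> klein_quadric"
  proof
    assume sub: "\<tau> \<subseteq> klein_quadric"
    then show False using pg_plane_not_Un_lines[OF m(6,1,2)] m(7) by (simp add: Int_absorb2)
  qed
qed

end

section \<open>The four contributions in a tangent hyperplane\<close>

theorem theorem3p3:
  fixes q :: nat
    and g \<pi> \<l> :: "('a::{field,finite}^6) set set"
    and P :: "('a^6) set"
    and Latin Greek \<X> \<Y> \<Z> \<S> \<T> :: "('a^6) set set set"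
    and G H C :: "(('a^6) set \<Rightarrow> ('a^6) set) set"
  assumes q: "q = CARD('a)"
    and families: "klein_families Latin Greek"
    and g: "g \<in> Greek"
    and \<X>_planes: "\<X> \<subseteq> pg_planes"
    and \<X>_card: "card \<X> = q ^ 6 - q ^ 3"
    and \<X>_disjoint: "\<forall>\<tau>\<in>\<X>. \<tau> \<inter> g = {}"
    and \<X>_conic: "\<forall>\<tau>\<in>\<X>. nondegenerate_conic_in \<tau> (\<tau> \<inter> klein_quadric)"
    and \<Y>: "\<Y> = Greek - {g}"
    and \<Z>: "\<Z> = {\<tau> \<in> pg_planes. \<exists>m\<in>pg_lines. m \<subseteq> g \<and> \<tau> \<inter> klein_quadric = m}"
    and \<l>: "\<l> \<in> pg_lines" "\<l> \<subseteq> g"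
    and \<pi>: "\<pi> \<in> Latin" "\<l> \<subseteq> \<pi>"
    and P: "P \<in> \<l>"
    and \<S>: "\<S> = {pg_span (m1 \<union> m2) | m1 m2.
                 m1 \<in> pg_lines \<and> m1 \<subseteq> \<pi> \<and> P \<in> m1 \<and> m1 \<noteq> \<l> \<and>
                 m2 \<in> pg_lines \<and> m2 \<subseteq> g \<and> P \<in> m2 \<and> m2 \<noteq> \<l>}"
    and G: "G = {f \<in> carrier PGL. f ` klein_quadric = klein_quadric}"
    and H_subgroup: "subgroup H PGL"
    and H_stabilizer: "H \<subseteq> {f \<in> G. f ` g = g}"
    and H_natural: "natural_PGL3_on g H"
    and C: "C \<subseteq> H" "singer_cyclic_on g C"
    and \<T>: "\<T> = {c ` \<tau> | c \<tau>. c \<in> C \<and> \<tau> \<in> \<S>}"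
  shows "\<exists>\<Gamma>\<in>pg5_hyperplanes.
           card {\<tau> \<in> \<X> \<union> \<Y> \<union> \<Z> \<union> \<T>. \<tau> \<subseteq> \<Gamma>} = q ^ 3 + 2 * q ^ 2 + q - 1"
proof -
  note singer_conjs = C(2)[unfolded singer_cyclic_on_def, THEN conjunct2, THEN conjunct2,
      THEN conjunct2]
  note singer = singer_conjs[THEN conjunct1] singer_conjs[THEN conjunct2]
  have C_in: "c \<in> carrier PGL" "c ` klein_quadric = klein_quadric" "c ` g = g" if "c \<in> C" for c
  proof -
    have "c \<in> {f \<in> G. f ` g = g}" by (rule subsetD[OF subset_trans[OF C(1) H_stabilizer] that])
    then show "c \<in> carrier PGL" "c ` klein_quadric = klein_quadric" "c ` g = g"
      unfolding G by simp_all
  qed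
  interpret klein_singer Latin Greek g \<pi> \<l> C
  proof
    show "\<exists>M. invertible M \<and> c = projectivity M" if "c \<in> C" for c
      using C_in(1)[OF that] by (auto simp: PGL_def)
    show "\<exists>!c. c \<in> C \<and> c p = p'" if "p \<in> g" "p' \<in> g" for p p'
      by (rule singer(1)[rule_format, OF that])
    show "\<exists>!c. c \<in> C \<and> c ` m = m'"
      if "m \<in> pg_lines" "m' \<in> pg_lines" "m \<subseteq> g" "m' \<subseteq> g" for m m'
      by (rule singer(2)[rule_format, OF that])
  qed (fact families g \<pi> \<l> C_in)+
  have P_g: "P \<in> g" using \<l>(2) P by (rule subsetD)
  \<comment> \<open>Tangency at any point of \<open>g\<close> gives a hyperplane through
    \<open>g\<close>; \<open>P\<close> is such a point.\<close>
  define \<Gamma> where "\<Gamma> = points_of (klein_perp P)"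
  have \<Gamma>: "\<Gamma> \<in> pg5_hyperplanes"
    unfolding \<Gamma>_def by (rule pg5_hyperplane_klein_perp[OF g_points[OF P_g]])
  have greek_iff: "h \<subseteq> \<Gamma> \<longleftrightarrow> P \<in> h" if "h \<in> Greek" for h
    unfolding \<Gamma>_def using family_plane[of h] that g_points[OF P_g]
    by (intro singular_plane_subset_klein_perp_iff) simp_all
  have \<T>_eq: "\<T> = (\<Union>c\<in>C. (`) c ` two_line_planes g \<pi> \<l> P)"
  proof -
    have "\<T> = (\<Union>c\<in>C. (`) c ` \<S>)" unfolding \<T> by auto
    then show ?thesis unfolding \<S> two_line_planes_def .
  qed
  define Y Z T where "Y = {h \<in> Greek - {g}. P \<in> h}"
    and "Z = {\<tau> \<in> pg_planes. (\<exists>m\<in>pg_lines. m \<subseteq> g \<and> \<tau> \<inter> klein_quadric = m) \<and> \<tau> \<subseteq> \<Gamma>}"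
    and "T = {\<tau> \<in> \<T>. \<tau> \<subseteq> \<Gamma>}"
  \<comment> \<open>\<open>g\<close> lies in \<open>\<Gamma>\<close> because \<open>P\<close> is on
    \<open>g\<close>, so a plane of \<open>\<Gamma>\<close> cannot avoid \<open>g\<close>.\<close>
  have "\<not> \<tau> \<subseteq> \<Gamma>" if "\<tau> \<in> \<X>" for \<tau>
    using pg5_planes_in_hyperplane_meet[OF subsetD[OF \<X>_planes that] _ g_plane _ \<Gamma>]
      \<X>_disjoint that greek_iff[OF g] P_g by auto
  moreover have "{\<tau> \<in> \<Y>. \<tau> \<subseteq> \<Gamma>} = Y"
    unfolding \<Y> Y_def using greek_iff by auto
  moreover have "{\<tau> \<in> \<Z>. \<tau> \<subseteq> \<Gamma>} = Z"
    unfolding \<Z> Z_def by simp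
  ultimately have split: "{\<tau> \<in> \<X> \<union> \<Y> \<union> \<Z> \<union> \<T>. \<tau> \<subseteq> \<Gamma>} = Y \<union> (Z \<union> T)"
    unfolding T_def by auto
  have Y_quadric: "\<tau> \<subseteq> klein_quadric \<and> \<tau> \<in> pg_planes" if "\<tau> \<in> Y" for \<tau>
    using that family_plane[of \<tau>] unfolding Y_def by simp
  have Z_line: "\<tau> \<inter> klein_quadric \<in> pg_lines" if "\<tau> \<in> Z" for \<tau>
    using that unfolding Z_def by auto
  have T_orbit: "\<tau> \<in> (\<Union>c\<in>C. (`) c ` two_line_planes g \<pi> \<l> P)" if "\<tau> \<in> T" for \<tau>
    using that unfolding T_def \<T>_eq by simp
  have "Y \<inter> Z = {}"
  proof (rule equals0I)
    fix \<tau> assume \<tau>: "\<tau> \<in> Y \<inter> Z"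
    then have "\<tau> \<in> pg_lines" "\<tau> \<in> pg_planes"
      using Z_line[of \<tau>] Y_quadric[of \<tau>] by (simp_all add: Int_absorb2)
    \<comment> \<open>A Greek plane is its own section, so \<open>\<tau>\<close> would be both a
      plane and a line; writing it as \<open>\<tau> \<union> \<tau>\<close> gives the excluded
      case.\<close>
    then show False using pg_plane_not_Un_lines[of \<tau> \<tau> \<tau>] by simp
  qed
  moreover have "Y \<inter> T = {}"
  proof (rule equals0I)
    fix \<tau> assume "\<tau> \<in> Y \<inter> T"
    then show False using Y_quadric[of \<tau>] orbit_two_line_planes_sections(1)[OF P T_orbit, of \<tau>] by simp
  qed
  moreover have "Z \<inter> T = {}"
  proof (rule equals0I)
    fix \<tau> assume "\<tau> \<in> Z \<inter> T"
    then show False using Z_line[of \<tau>] orbit_two_line_planes_sections(2)[OF P T_orbit, of \<tau>] by simp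
  qed
  ultimately have "card (Y \<union> (Z \<union> T)) = card Y + (card Z + card T)"
    by (simp add: card_Un_disjoint Int_Un_distrib)
  also have "card Y = q" unfolding Y_def q by (rule card_Greek_through_point[OF P_g])
  also have "card Z = (q + 1) * (q - 1)"
    unfolding Z_def \<Gamma>_def q by (rule card_tangent_planes_in_hyperplane[OF P_g])
  also have "card T = (q + 1) * q\<^sup>2"
    unfolding T_def \<T>_eq \<Gamma>_def q by (rule card_two_line_planes_in_hyperplane[OF P P_g])
  also have "q + ((q + 1) * (q - 1) + (q + 1) * q\<^sup>2) = q ^ 3 + 2 * q\<^sup>2 + q - 1"
  proof -
    \<comment> \<open>With \<open>q = r + 2\<close> the natural subtractions become exact.\<close>
    obtain r where "q = r + 2"
      unfolding q using CARD_field_ge_2[where 'a='a] by (metis add.commute le_Suc_ex)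
    then show ?thesis by (simp add: power3_eq_cube power2_eq_square algebra_simps)
  qed
  finally have "card (Y \<union> (Z \<union> T)) = q ^ 3 + 2 * q\<^sup>2 + q - 1" .
  then show ?thesis unfolding split[symmetric] by (rule bexI[OF _ \<Gamma>])
qed

end
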